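(* Suppose that $\tau$ is recurrent, i.e. $\mathbf{P}(\tau_1<\infty)=1$, and that $\mathbf{P}(\tau_1=n)=\varphi(n)\,n^{-1}$ for all integers $n\ge 1$, where $\varphi$ is a positive slowly varying function. Throughout, $n\ge k\geq 1$. (i) For each $M>0$ there exists $a_M>0$, with $a_M\to1$ as $M\to0$, such that if $n$ is sufficiently large (depending on $M$) and $k\varphi(n)\le M$, then $$a_M(1-r_n)^k\le\mathbf{P}(\tau_k\le n)\le(1-r_n)^k.$$ (ii) If $k,n\to+\infty$ with $k\varphi(n)\to+\infty$ and $n/k\to+\infty$, then $$\mathbf{P}(\tau_k\le n)=\exp\left\{-(1+o(1))\,k\,r\!\left(\frac nk\,\varphi^*\!\left(\frac nk\right)\right)\right\}.$$ (iii) For every real $b\ge1$ the limit $$-I(b)=\lim_{k\to\infty}\frac1k\log\mathbf{P}(\tau_k\le bk)$$ exists, and it is finite if $b\ge\min\{j:\mathbf{P}(\tau_1=j)>0\}$. Moreover, $$I(b)\sim r\big(b\,\varphi^*(b)\big)\qquad\text{as } b\to+\infty.$$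
   Context: $\tau=\{0=\tau_0,\tau_1,\tau_2,\dots\}$ is a renewal process: the increments $\tau_i-\tau_{i-1}$, $i\ge1$, are i.i.d. with values in $\{1,2,3,\dots\}$, so $\tau_k$ is the sum of $k$ i.i.d. copies of $\tau_1$. Notation: $r(x):=\mathbf{P}(\tau_1>x)$ for real $x\geq 0$ and $r_n:=r(n)$. A positive function $\varphi$ is slowly varying if $\varphi(\lambda x)/\varphi(x)\to1$ as $x\to\infty$ for every $\lambda>0$; $\varphi$ given on the positive integers is regarded as a function on $[1,\infty)$ via, e.g., $\varphi(x)=\varphi(\lfloor x\rfloor)$. $\varphi^*$ denotes a slowly varying function conjugate to $\varphi$, that is, a slowly varying function such that $g(x)=x\varphi^*(x)$ is an asymptotic inverse of $f(y)=y\varphi(y)$, meaning $f(g(x))\sim x$ and $g(f(x))\sim x$ as $x\to\infty$ (such $\varphi^*$ exists and is unique up to asymptotic equivalence). In (ii), the $o(1)$ is understood along any sequence of pairs $(k,n)$ satisfying the stated limits. *)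

theory Defs
  imports "HOL-Probability.Probability" "HOL-Library.Landau_Symbols"
begin

text \<open>
  The increments may take the value \<open>\<infinity>\<close>, so that recurrence (\<open>\<tau> 1\<close> almost surely finite)
  is a genuine condition.
\<close>

definition renewal_process :: "'a measure \<Rightarrow> (nat \<Rightarrow> 'a \<Rightarrow> enat) \<Rightarrow> bool" where
  "renewal_process M \<tau> \<longleftrightarrow>
     prob_space M \<and>
     (\<exists>\<xi>. prob_space.indep_vars M (\<lambda>_. count_space UNIV) \<xi> UNIV \<and>
          (\<forall>i. distr M (count_space UNIV) (\<xi> i) = distr M (count_space UNIV) (\<xi> 0)) \<and>
          (\<forall>i. \<forall>\<omega>\<in>space M. 1 \<le> \<xi> i \<omega>) \<and>
          (\<forall>k. \<forall>\<omega>\<in>space M. \<tau> k \<omega> = (\<Sum>i<k. \<xi> i \<omega>)))"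

definition recurrent :: "'a measure \<Rightarrow> (nat \<Rightarrow> 'a \<Rightarrow> enat) \<Rightarrow> bool" where
  "recurrent M \<tau> \<longleftrightarrow> \<P>(\<omega> in M. \<tau> 1 \<omega> < \<infinity>) = 1"

definition renewal_tail :: "'a measure \<Rightarrow> (nat \<Rightarrow> 'a \<Rightarrow> enat) \<Rightarrow> real \<Rightarrow> real" where
  "renewal_tail M \<tau> x = \<P>(\<omega> in M. ereal_of_enat (\<tau> 1 \<omega>) > ereal x)"

text \<open>Only the values on \<open>[1, \<infinity>)\<close> are meaningful.\<close>

definition slowly_varying :: "(real \<Rightarrow> real) \<Rightarrow> bool" where
  "slowly_varying L \<longleftrightarrow>
     (\<forall>x\<ge>1. L x > 0) \<and> (\<forall>c>0. ((\<lambda>x. L (c * x) / L x) \<longlongrightarrow> 1) at_top)"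

definition step_extension :: "(nat \<Rightarrow> real) \<Rightarrow> real \<Rightarrow> real" where
  "step_extension \<phi> x = \<phi> (nat \<lfloor>x\<rfloor>)"

definition conjugate_slowly_varying :: "(real \<Rightarrow> real) \<Rightarrow> (real \<Rightarrow> real) \<Rightarrow> bool" where
  "conjugate_slowly_varying L L' \<longleftrightarrow>
     slowly_varying L' \<and>
     (let f = (\<lambda>y. y * L y); g = (\<lambda>x. x * L' x)
      in (\<lambda>x. f (g x)) \<sim>[at_top] (\<lambda>x. x) \<and> (\<lambda>x. g (f x)) \<sim>[at_top] (\<lambda>x. x))"

text \<open>The logarithm of a probability, with \<open>log 0 = -\<infinity>\<close> (whereas \<open>ln 0 = 0\<close> on the reals).\<close>

definition log_prob :: "real \<Rightarrow> ereal" where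
  "log_prob p = (if p = 0 then -\<infinity> else ereal (ln p))"

end

theory Submission
  imports Defs
begin

text \<open>
  Write \<open>p\<^sub>j = \<phi> j / j\<close> for the law of one increment, \<open>S n = \<Sum>\<^sub>j\<^sub>\<le>\<^sub>n j p\<^sub>j\<close> for its truncated mean
  (below \<open>trunc_mean n\<close>) and \<open>r n\<close> for its tail. Since \<open>\<phi>\<close> is slowly varying, \<open>S n\<close> has order
  \<open>n \<phi> n\<close>, while \<open>r\<close> is a sum of \<open>\<phi> j / j\<close> over all scales beyond \<open>n\<close> and is therefore much larger
  than the contribution \<open>\<phi> n\<close> of any single scale: \<open>\<phi> n = o(r n)\<close>, whereas
  \<open>r n - r (\<Lambda> n) = O(\<phi> n)\<close> for fixed \<open>\<Lambda>\<close>. So \<open>r\<close> is unchanged, to leading order, when its argument is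
  multiplied by a constant, and constants in the choice of a truncation level do not matter.

  The event \<open>\<tau>\<^sub>k \<le> n\<close> is realised most cheaply by forbidding increments above a level \<open>m\<close> and letting
  the rest behave typically. Truncating at \<open>m / D\<close> costs \<open>(1 - r (m / D))\<^sup>k\<close>, and the truncated sum
  has mean \<open>O(k m \<phi> m / D)\<close>; by Markov's inequality it is below \<open>n\<close> with probability bounded away from
  zero as soon as \<open>D\<close> is large and \<open>k m \<phi> m = O(n)\<close> (\<open>F_ge_truncated_power\<close>). Conversely, when
  \<open>n = O(k m \<phi> m)\<close>, Chernoff's inequality with parameter \<open>1 / m\<close> costs only a factor
  \<open>exp (n / m) = exp (O(k \<phi> m)) = exp (o(k r m))\<close> and gives the matching upper bound
  (\<open>F_le_exp_tail\<close>).

  For (i) the level is of order \<open>n\<close>, and \<open>n\<close> itself when the bound on \<open>k \<phi> n\<close> is small, so that the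
  constant tends to \<open>1\<close>; the upper bound is the probability that no increment exceeds \<open>n\<close>. For (ii) and (iii) the level solves \<open>m \<phi> m \<approx> b\<close> with \<open>b = n / k\<close>, which is what
  \<open>m = b \<phi>\<^sup>* b\<close> does. The two bounds then read \<open>exp (- (1 \<plusminus> \<eta>) k r m)\<close> up to a factor \<open>2\<close>,
  uniformly in \<open>k\<close> as \<open>b \<rightarrow> \<infinity>\<close> (\<open>F_bounds_at_truncation_level\<close>). This yields (ii) because \<open>k r m\<close>
  tends to infinity under its hypotheses, and (iii) on letting \<open>k \<rightarrow> \<infinity>\<close> for fixed \<open>b\<close>, where the
  limit exists by subadditivity (Fekete's lemma).

  Everything about sums of increments is derived from the recursion for the distribution function
  obtained by conditioning on one increment.
\<close>

section \<open>Distribution functions of sums of independent increments\<close>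

text \<open>
  The distribution function of the sum of \<open>k\<close> independent variables with mass function \<open>p\<close> on the
  naturals, by conditioning on one of them. Working with this recursion turns each probabilistic
  inequality into an induction on \<open>k\<close>; mass escaping to \<open>\<infinity>\<close> just makes \<open>p\<close> sum to less than \<open>1\<close>.
\<close>
primrec sum_cdf :: "(nat \<Rightarrow> real) \<Rightarrow> nat \<Rightarrow> nat \<Rightarrow> real" where
  "sum_cdf p 0 n = 1"
| "sum_cdf p (Suc k) n = (\<Sum>j\<le>n. p j * sum_cdf p k (n - j))"

lemma measurable_add_count_space_countable:
  fixes f g :: "'a \<Rightarrow> 'b::{countable, plus}"
  assumes "f \<in> N \<rightarrow>\<^sub>M count_space UNIV" "g \<in> N \<rightarrow>\<^sub>M count_space UNIV"
  shows "(\<lambda>x. f x + g x) \<in> N \<rightarrow>\<^sub>M count_space UNIV"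
proof (rule measurable_compose_countable'[where I = UNIV and g = f and f = "\<lambda>i x. i + g x"])
  show "(\<lambda>x. i + g x) \<in> N \<rightarrow>\<^sub>M count_space UNIV" for i
    by (rule measurable_compose[OF assms(2)]) simp
qed (use assms in auto)

lemma (in prob_space) prob_sum_le_eq_sum_cdf:
  fixes \<xi> :: "nat \<Rightarrow> 'a \<Rightarrow> enat"
  assumes indep: "indep_vars (\<lambda>_. count_space UNIV) \<xi> UNIV"
    and dist: "\<And>i. distr M (count_space UNIV) (\<xi> i) = distr M (count_space UNIV) (\<xi> 0)"
  shows "\<P>(\<omega> in M. (\<Sum>i<k. \<xi> i \<omega>) \<le> enat n) = sum_cdf (\<lambda>j. \<P>(\<omega> in M. \<xi> 0 \<omega> = enat j)) k n"
proof (induction k arbitrary: n)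
  case 0
  then show ?case by (simp add: prob_space zero_enat_def[symmetric])
next
  case (Suc k)
  have meas: "\<xi> i \<in> M \<rightarrow>\<^sub>M count_space UNIV" for i
    using indep unfolding indep_vars_def by auto
  define T where "T \<omega> = (\<Sum>i<k. \<xi> i \<omega>)" for \<omega>
  have sums_meas: "(\<lambda>f. \<Sum>i<l. f i) \<in> PiM {..<k} (\<lambda>_. count_space UNIV) \<rightarrow>\<^sub>M count_space (UNIV :: enat set)"
    if "l \<le> k" for l
    using that
  proof (induction l)
    case (Suc l)
    then show ?case
      by (simp only: sum.lessThan_Suc)
        (intro measurable_add_count_space_countable measurable_component_singleton, auto)
  qed auto
  have "indep_var (count_space UNIV) ((\<lambda>f. f k) \<circ> (\<lambda>\<omega>. restrict (\<lambda>i. \<xi> i \<omega>) {k}))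
      (count_space UNIV) ((\<lambda>f. \<Sum>i<k. f i) \<circ> (\<lambda>\<omega>. restrict (\<lambda>i. \<xi> i \<omega>) {..<k}))"
    using sums_meas[of k]
    by (intro indep_var_compose[OF indep_var_restrict[OF indep]]) (auto intro: measurable_component_singleton)
  also have "((\<lambda>f. f k) \<circ> (\<lambda>\<omega>. restrict (\<lambda>i. \<xi> i \<omega>) {k})) = \<xi> k"
    by auto
  also have "((\<lambda>f. \<Sum>i<k. f i) \<circ> (\<lambda>\<omega>. restrict (\<lambda>i. \<xi> i \<omega>) {..<k})) = T"
    by (auto simp: T_def)
  finally have ind: "indep_var (count_space UNIV) (\<xi> k) (count_space UNIV) T" .
  have measT: "T \<in> M \<rightarrow>\<^sub>M count_space UNIV"
    using ind by (rule indep_var_rv2)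
  have split: "{\<omega>\<in>space M. (\<Sum>i<Suc k. \<xi> i \<omega>) \<le> enat n} =
      (\<Union>j\<le>n. (\<lambda>\<omega>. (\<xi> k \<omega>, T \<omega>)) -` ({enat j} \<times> {..enat (n - j)}) \<inter> space M)"
  proof -
    have "x + y \<le> enat n \<longleftrightarrow> (\<exists>j\<le>n. y = enat j \<and> x \<le> enat (n - j))" for x y :: enat
      by (cases x; cases y) auto
    then show ?thesis by (auto simp: T_def)
  qed
  have pt: "prob (\<xi> k -` {enat j} \<inter> space M) = \<P>(\<omega> in M. \<xi> 0 \<omega> = enat j)" for j
  proof -
    have "prob (\<xi> k -` {enat j} \<inter> space M) = measure (distr M (count_space UNIV) (\<xi> k)) {enat j}"
      using meas by (simp add: measure_distr)
    also have "\<dots> = prob (\<xi> 0 -` {enat j} \<inter> space M)"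
      unfolding dist[of k] using meas by (simp add: measure_distr)
    also have "\<xi> 0 -` {enat j} \<inter> space M = {\<omega>\<in>space M. \<xi> 0 \<omega> = enat j}" by auto
    finally show ?thesis .
  qed
  have pT: "prob (T -` {..enat m} \<inter> space M) = sum_cdf (\<lambda>j. \<P>(\<omega> in M. \<xi> 0 \<omega> = enat j)) k m" for m
  proof -
    have "T -` {..enat m} \<inter> space M = {\<omega>\<in>space M. (\<Sum>i<k. \<xi> i \<omega>) \<le> enat m}"
      by (auto simp: T_def)
    then show ?thesis using Suc.IH by simp
  qed
  have ev: "(\<lambda>\<omega>. (\<xi> k \<omega>, T \<omega>)) -` ({enat j} \<times> {..enat (n - j)}) \<inter> space M \<in> events" for j
  proof -
    have "(\<lambda>\<omega>. (\<xi> k \<omega>, T \<omega>)) -` ({enat j} \<times> {..enat (n - j)}) \<inter> space M =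
        (\<xi> k -` {enat j} \<inter> space M) \<inter> (T -` {..enat (n - j)} \<inter> space M)" by auto
    also have "\<dots> \<in> events"
      using meas[of k] measT by (intro sets.Int measurable_sets) auto
    finally show ?thesis .
  qed
  have "prob {\<omega>\<in>space M. (\<Sum>i<Suc k. \<xi> i \<omega>) \<le> enat n} =
      (\<Sum>j\<le>n. prob ((\<lambda>\<omega>. (\<xi> k \<omega>, T \<omega>)) -` ({enat j} \<times> {..enat (n - j)}) \<inter> space M))"
    unfolding split
    by (rule finite_measure_finite_Union) (use ev in \<open>auto simp: disjoint_family_on_def\<close>)
  also have "\<dots> = (\<Sum>j\<le>n. \<P>(\<omega> in M. \<xi> 0 \<omega> = enat j) * sum_cdf (\<lambda>j. \<P>(\<omega> in M. \<xi> 0 \<omega> = enat j)) k (n - j))"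
    by (intro sum.cong refl, subst indep_varD[OF ind]) (simp_all add: pt pT)
  finally show ?case by simp
qed

lemma sum_cdf_nonneg:
  assumes "\<And>j. p j \<ge> 0"
  shows "sum_cdf p k n \<ge> 0"
  using assms by (induction k arbitrary: n) (auto intro!: sum_nonneg)

lemma sum_cdf_mono:
  assumes "\<And>j. p j \<ge> 0" "m \<le> n"
  shows "sum_cdf p k m \<le> sum_cdf p k n"
  using assms(2)
proof (induction k arbitrary: m n)
  case (Suc k)
  have "(\<Sum>j\<le>m. p j * sum_cdf p k (m - j)) \<le> (\<Sum>j\<le>m. p j * sum_cdf p k (n - j))"
    using Suc assms by (intro sum_mono mult_left_mono) auto
  also have "\<dots> \<le> (\<Sum>j\<le>n. p j * sum_cdf p k (n - j))"
    using Suc.prems assms by (intro sum_mono2) (auto intro!: mult_nonneg_nonneg sum_cdf_nonneg)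
  finally show ?case by simp
qed simp

lemma sum_cdf_ge_power:
  assumes "\<And>j. p j \<ge> 0" "k \<le> n"
  shows "p 1 ^ k \<le> sum_cdf p k n"
  using assms(2)
proof (induction k arbitrary: n)
  case (Suc k)
  have "p 1 * p 1 ^ k \<le> p 1 * sum_cdf p k (n - 1)"
    using Suc assms by (intro mult_left_mono) auto
  also have "\<dots> \<le> (\<Sum>j\<le>n. p j * sum_cdf p k (n - j))"
    using Suc.prems assms sum_cdf_nonneg[of p]
    by (intro member_le_sum[where f = "\<lambda>j. p j * sum_cdf p k (n - j)"]) auto
  finally show ?case by simp
qed simp

text \<open>The first \<open>k\<close> increments may sum to at most \<open>n\<close> and the other \<open>l\<close> to at most \<open>m\<close>.\<close>
lemma sum_cdf_supermult:
  assumes "\<And>j. p j \<ge> 0"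
  shows "sum_cdf p k n * sum_cdf p l m \<le> sum_cdf p (k + l) (n + m)"
proof (induction k arbitrary: n)
  case 0
  then show ?case using sum_cdf_mono[OF assms, of m "n + m"] by simp
next
  case (Suc k)
  have "sum_cdf p (Suc k) n * sum_cdf p l m = (\<Sum>j\<le>n. p j * (sum_cdf p k (n - j) * sum_cdf p l m))"
    by (simp add: sum_distrib_right mult.assoc)
  also have "\<dots> \<le> (\<Sum>j\<le>n. p j * sum_cdf p (k + l) (n - j + m))"
    by (intro sum_mono mult_left_mono Suc.IH assms)
  also have "\<dots> = (\<Sum>j\<le>n. p j * sum_cdf p (k + l) (n + m - j))"
    by (intro sum.cong) auto
  also have "\<dots> \<le> (\<Sum>j\<le>n + m. p j * sum_cdf p (k + l) (n + m - j))"
    using assms by (intro sum_mono2) (auto intro!: mult_nonneg_nonneg sum_cdf_nonneg)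
  finally show ?case by simp
qed

text \<open>If the sum is at most \<open>n\<close> then so is each of the \<open>k\<close> increments.\<close>
lemma sum_cdf_le_power:
  assumes "\<And>j. p j \<ge> 0"
  shows "sum_cdf p k n \<le> (\<Sum>j\<le>n. p j) ^ k"
proof -
  have "sum_cdf p k m \<le> (\<Sum>j\<le>n. p j) ^ k" if "m \<le> n" for m
    using that
  proof (induction k arbitrary: m)
    case (Suc k)
    have "sum_cdf p (Suc k) m \<le> (\<Sum>j\<le>m. p j * (\<Sum>j\<le>n. p j) ^ k)"
      using Suc assms by (auto intro!: sum_mono mult_left_mono)
    also have "\<dots> \<le> (\<Sum>j\<le>n. p j * (\<Sum>j\<le>n. p j) ^ k)"
      using Suc.prems assms by (intro sum_mono2) (auto intro!: mult_nonneg_nonneg sum_nonneg zero_le_power)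
    finally show ?case by (simp add: sum_distrib_right)
  qed simp
  then show ?thesis by simp
qed

text \<open>
  Chernoff's inequality; \<open>G\<close> bounds the Laplace transform of one increment at \<open>l\<close>.
\<close>
lemma sum_cdf_chernoff:
  assumes nonneg: "\<And>j. p j \<ge> 0" and G: "\<And>n. (\<Sum>j\<le>n. p j * exp (- l * real j)) \<le> G"
    and l: "l \<ge> 0"
  shows "sum_cdf p k n \<le> exp (l * real n) * G ^ k"
proof (induction k arbitrary: n)
  case 0
  then show ?case using l by simp
next
  case (Suc k)
  have "0 \<le> (\<Sum>j\<le>0. p j * exp (- l * real j))" using nonneg by simp
  with G[of 0] have "G \<ge> 0" by linarith
  have "sum_cdf p (Suc k) n \<le> (\<Sum>j\<le>n. p j * (exp (l * real (n - j)) * G ^ k))"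
    unfolding sum_cdf.simps by (intro sum_mono mult_left_mono Suc.IH nonneg)
  also have "\<dots> = (\<Sum>j\<le>n. exp (l * real n) * G ^ k * (p j * exp (- l * real j)))"
    by (intro sum.cong) (auto simp: of_nat_diff exp_diff exp_minus right_diff_distrib field_simps)
  also have "\<dots> = exp (l * real n) * G ^ k * (\<Sum>j\<le>n. p j * exp (- l * real j))"
    by (simp add: sum_distrib_left)
  also have "\<dots> \<le> exp (l * real n) * G ^ k * G"
    using \<open>G \<ge> 0\<close> by (intro mult_left_mono G) auto
  finally show ?case by (simp add: algebra_simps)
qed

text \<open>
  With \<open>t = n\<close> this is Markov's inequality on the event that all increments are at most \<open>N\<close>: that event
  has probability \<open>q\<^sup>k\<close>, and the sum restricted to it has expectation \<open>k S q\<^sup>k\<^sup>-\<^sup>1\<close>. In an induction on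
  \<open>k\<close> the bound \<open>n\<close> decreases while the normalisation must not, which is why \<open>t\<close> is a separate
  parameter: the left-hand side is the expectation of \<open>n - \<tau>\<^sub>k\<close> on the event, which is at most \<open>t\<close>
  times the probability that this difference is nonnegative.
\<close>
lemma sum_cdf_truncated_markov:
  assumes nonneg: "\<And>j. p j \<ge> 0"
    and q: "q = (\<Sum>j\<le>N. p j)" and S: "S = (\<Sum>j\<le>N. real j * p j)" and n: "real n \<le> t"
  shows "real n * q ^ k - real k * S * q ^ (k - 1) \<le> t * sum_cdf p k n"
  using n
proof (induction k arbitrary: n)
  case 0
  then show ?case by simp
next
  case (Suc k)
  have q0: "q \<ge> 0" and S0: "S \<ge> 0" using nonneg by (auto simp: q S intro!: sum_nonneg)
  have t0: "t \<ge> 0" using Suc.prems of_nat_0_le_iff[of n, where ?'a = real] by linarith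
  define c where "c = real k * S * q ^ (k - 1)"
  have c0: "c \<ge> 0" using q0 S0 by (simp add: c_def)
  have cq: "c * q = real k * S * q ^ k"
    by (cases k) (auto simp: c_def)
  \<comment> \<open>Terms with \<open>j > n\<close> are nonpositive and can be dropped.\<close>
  have "(\<Sum>j\<le>N. p j * ((real n - real j) * q ^ k - c)) \<le>
      (\<Sum>j\<in>{..N} \<inter> {..n}. p j * ((real n - real j) * q ^ k - c))"
  proof -
    have "(\<Sum>j\<in>{..N} \<inter> {..n}. - (p j * ((real n - real j) * q ^ k - c)))
        \<le> (\<Sum>j\<le>N. - (p j * ((real n - real j) * q ^ k - c)))"
    proof (intro sum_mono2)
      fix j assume "j \<in> {..N} - {..N} \<inter> {..n}"
      then have "(real n - real j) * q ^ k \<le> 0" using q0 by (intro mult_nonpos_nonneg) auto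
      then have "p j * ((real n - real j) * q ^ k - c) \<le> 0"
        using nonneg c0 by (intro mult_nonneg_nonpos) auto
      then show "0 \<le> - (p j * ((real n - real j) * q ^ k - c))" by simp
    qed auto
    then show ?thesis by (simp add: sum_negf)
  qed
  also have "\<dots> \<le> (\<Sum>j\<in>{..N} \<inter> {..n}. p j * (t * sum_cdf p k (n - j)))"
  proof (intro sum_mono mult_left_mono nonneg)
    fix j assume "j \<in> {..N} \<inter> {..n}"
    then have "real (n - j) = real n - real j" "real (n - j) \<le> t"
      using Suc.prems by (auto simp: of_nat_diff)
    with Suc.IH[of "n - j"] show "(real n - real j) * q ^ k - c \<le> t * sum_cdf p k (n - j)"
      by (simp add: c_def)
  qed
  also have "\<dots> \<le> (\<Sum>j\<le>n. p j * (t * sum_cdf p k (n - j)))"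
    using nonneg t0 by (intro sum_mono2) (auto intro!: mult_nonneg_nonneg sum_cdf_nonneg)
  also have "\<dots> = t * sum_cdf p (Suc k) n"
    by (simp add: sum_distrib_left mult_ac)
  finally have "(\<Sum>j\<le>N. p j * ((real n - real j) * q ^ k - c)) \<le> t * sum_cdf p (Suc k) n" .
  moreover have "(\<Sum>j\<le>N. p j * ((real n - real j) * q ^ k - c)) =
      (real n * q ^ k - c) * q - q ^ k * S"
    by (simp add: q S sum_distrib_left sum_distrib_right sum_subtractf[symmetric] algebra_simps)
  ultimately show ?case using cq by (simp add: algebra_simps)
qed

section \<open>Local boundedness of slowly varying sequences\<close>

lemma slowly_varying_step_pos:
  assumes "slowly_varying (step_extension \<phi>)" "n \<ge> 1"
  shows "\<phi> n > 0"
proof -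
  have "step_extension \<phi> (real n) > 0"
    using assms unfolding slowly_varying_def by simp
  then show ?thesis by (simp add: step_extension_def)
qed

text \<open>
  The weak form of the uniform convergence theorem for slowly varying functions that is needed here.
  By continuity of measure, all multipliers \<open>x\<close> in \<open>{1..2\<Lambda>}\<close> outside a set of small measure satisfy
  \<open>\<phi> \<lfloor>x n\<rfloor> \<approx> \<phi> n\<close> up to a factor \<open>2\<close> simultaneously for all large \<open>n\<close>. If \<open>n \<le> m \<le> \<Lambda> n\<close>, some \<open>x\<close>
  is good for \<open>n\<close> while \<open>x n / m\<close> is good for \<open>m\<close>; both multipliers lead to the same point
  \<open>\<lfloor>x n\<rfloor>\<close>, through which \<open>\<phi> n\<close> and \<open>\<phi> m\<close> are compared.
\<close>
lemma slowly_varying_step_locally_bounded: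
  fixes \<Lambda> :: real
  assumes sv: "slowly_varying (step_extension \<phi>)" and \<Lambda>: "\<Lambda> \<ge> 1"
  shows "\<forall>\<^sub>F n in sequentially. \<forall>m. n \<le> m \<and> real m \<le> \<Lambda> * real n \<longrightarrow> \<phi> m \<le> 4 * \<phi> n \<and> \<phi> n \<le> 4 * \<phi> m"
proof -
  define bad where "bad n = {x \<in> {1..2*\<Lambda>}. \<not> (\<phi> (nat \<lfloor>x * real n\<rfloor>) \<le> 2 * \<phi> n \<and> \<phi> n \<le> 2 * \<phi> (nat \<lfloor>x * real n\<rfloor>))}" for n
  define B where "B N = (\<Union>n\<in>{N..}. bad n)" for N
  have bad_sets: "bad n \<in> sets borel" for n
    unfolding bad_def by measurable
  have B_sets: "B N \<in> sets borel" for N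
    unfolding B_def using bad_sets by auto
  have B_sub: "B N \<subseteq> {1..2*\<Lambda>}" for N
    by (auto simp: B_def bad_def)
  have B_fin: "emeasure lborel (B N) < \<infinity>" for N
  proof -
    have "emeasure lborel (B N) \<le> emeasure lborel {1..2*\<Lambda>}"
      using B_sub by (intro emeasure_mono) auto
    then show ?thesis using \<Lambda> by (auto simp: less_top[symmetric] top_unique)
  qed
  have B_empty: "(\<Inter>N. B N) = {}"
  proof (intro equals0I)
    fix x assume x: "x \<in> (\<Inter>N. B N)"
    then have x1: "x \<ge> 1" using B_sub[of 0] by auto
    have "((\<lambda>y. step_extension \<phi> (x * y) / step_extension \<phi> y) \<longlongrightarrow> 1) at_top"
      using sv x1 by (auto simp: slowly_varying_def)
    then have "(\<lambda>n. step_extension \<phi> (x * real n) / step_extension \<phi> (real n)) \<longlonglongrightarrow> 1"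
      by (rule filterlim_compose) (rule filterlim_real_sequentially)
    then have "(\<lambda>n. \<phi> (nat \<lfloor>x * real n\<rfloor>) / \<phi> n) \<longlonglongrightarrow> 1"
      by (simp add: step_extension_def)
    then have "\<forall>\<^sub>F n in sequentially. \<phi> (nat \<lfloor>x * real n\<rfloor>) / \<phi> n < 2 \<and> \<phi> (nat \<lfloor>x * real n\<rfloor>) / \<phi> n > 1/2 \<and> n \<ge> 1"
      by (intro eventually_conj order_tendstoD eventually_ge_at_top) auto
    then obtain N where N: "\<And>n. n \<ge> N \<Longrightarrow> \<phi> (nat \<lfloor>x * real n\<rfloor>) / \<phi> n < 2 \<and> \<phi> (nat \<lfloor>x * real n\<rfloor>) / \<phi> n > 1/2 \<and> n \<ge> 1"
      by (auto simp: eventually_sequentially)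
    from x obtain n where n: "n \<ge> N" "x \<in> bad n"
      by (auto simp: B_def)
    have "\<phi> n > 0" using N[OF n(1)] slowly_varying_step_pos[OF sv] by auto
    with N[OF n(1)] n(2) show False
      by (auto simp: bad_def field_simps)
  qed
  have "(\<lambda>N. measure lborel (B N)) \<longlonglongrightarrow> measure lborel (\<Inter>N. B N)"
  proof (rule Lim_measure_decseq)
    show "range B \<subseteq> sets lborel" using B_sets by auto
    show "decseq B" unfolding decseq_def B_def by (intro allI impI UN_mono) auto
    show "emeasure lborel (B N) \<noteq> \<infinity>" for N using B_fin[of N] by simp
  qed
  then have "(\<lambda>N. measure lborel (B N)) \<longlonglongrightarrow> 0" by (simp add: B_empty)
  then have "\<forall>\<^sub>F N in sequentially. measure lborel (B N) < \<Lambda> / (1 + \<Lambda>)"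
    using \<Lambda> by (intro order_tendstoD) auto
  then obtain N where N: "measure lborel (B N) < \<Lambda> / (1 + \<Lambda>)"
    by (auto simp: eventually_sequentially)
  have "\<phi> m \<le> 4 * \<phi> n \<and> \<phi> n \<le> 4 * \<phi> m" if n: "n \<ge> max N 1" and m: "n \<le> m" "real m \<le> \<Lambda> * real n" for n m
  proof -
    define c where "c = real n / real m"
    have c: "c > 0" "c \<le> 1" "c * \<Lambda> \<ge> 1"
      using n m by (auto simp: c_def field_simps)
    define C where "C = (\<lambda>x. c * x) -` B N"
    have C_sets: "C \<in> sets borel"
      unfolding C_def using B_sets[of N] by (intro measurable_sets_borel) auto
    have eC: "emeasure lborel C = ennreal (1 / c) * emeasure lborel (B N)"
    proof -
      have "emeasure lborel (B N) = emeasure (density (distr lborel borel ((*) c)) (\<lambda>_. ennreal \<bar>c\<bar>)) (B N)"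
        using c lborel_distr_mult'[of c] by simp
      also have "\<dots> = ennreal c * emeasure lborel C"
        using c B_sets[of N] by (simp add: emeasure_density_const emeasure_distr C_def)
      finally show ?thesis
        using c by (simp add: mult.assoc[symmetric] ennreal_mult[symmetric])
    qed
    have mC: "measure lborel C = 1 / c * measure lborel (B N)"
      using c by (simp add: measure_def eC enn2real_mult)
    have C_fin: "emeasure lborel C < \<infinity>"
      using B_fin[of N] unfolding eC by (simp add: ennreal_mult_less_top)
    \<comment> \<open>\<open>C\<close> has at most \<open>\<Lambda>\<close> times the measure of \<open>B N\<close>, hence the threshold \<open>\<Lambda> / (1 + \<Lambda>)\<close> above.\<close>
    have "\<not> {\<Lambda>..2*\<Lambda>} \<subseteq> B N \<union> C"
    proof
      assume "{\<Lambda>..2*\<Lambda>} \<subseteq> B N \<union> C"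
      then have "measure lborel {\<Lambda>..2*\<Lambda>} \<le> measure lborel (B N \<union> C)"
        using B_sets C_sets B_fin C_fin
        by (intro measure_mono_fmeasurable fmeasurable.Un) (auto simp: fmeasurable_def)
      also have "\<dots> \<le> measure lborel (B N) + measure lborel C"
        using B_sets C_sets by (intro measure_Un_le) auto
      also have "\<dots> = (1 + 1 / c) * measure lborel (B N)"
        by (simp add: mC algebra_simps)
      also have "\<dots> \<le> (1 + \<Lambda>) * measure lborel (B N)"
        using c by (intro mult_right_mono) (auto simp: field_simps)
      also have "\<dots> < \<Lambda>"
        using N \<Lambda> by (simp add: field_simps)
      finally show False using \<Lambda> by simp
    qed
    then obtain x where "x \<in> {\<Lambda>..2*\<Lambda>}" "x \<notin> B N \<union> C"
      by blast
    then have x: "\<Lambda> \<le> x" "x \<le> 2 * \<Lambda>" "x \<notin> B N" "c * x \<notin> B N"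
      by (simp_all add: C_def)
    have "x \<notin> bad n" "c * x \<notin> bad m"
      using x n m by (auto simp: B_def)
    moreover have "1 \<le> c * x" "c * x \<le> 2 * \<Lambda>"
    proof -
      have "c * \<Lambda> \<le> c * x" using c x by (intro mult_left_mono) auto
      then show "1 \<le> c * x" using c by linarith
      have "c * x \<le> 1 * x" using c x \<Lambda> by (intro mult_right_mono) auto
      then show "c * x \<le> 2 * \<Lambda>" using x by linarith
    qed
    moreover have "c * x * real m = x * real n"
      using n m by (simp add: c_def)
    ultimately show ?thesis
      using x \<Lambda> by (auto simp: bad_def)
  qed
  then show ?thesis
    unfolding eventually_sequentially by blast
qed

section \<open>Tail and truncated mean\<close>

text \<open>
  Dividing by \<open>real 0 = 0\<close> gives \<open>0\<close>, so the term of index \<open>0\<close> vanishes.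
\<close>
locale slowly_varying_law =
  fixes \<phi> :: "nat \<Rightarrow> real"
  assumes sv: "slowly_varying (step_extension \<phi>)"
    and sums_one: "(\<lambda>j. \<phi> j / real j) sums 1"
begin

definition p :: "nat \<Rightarrow> real" where "p j = \<phi> j / real j"

definition tail :: "nat \<Rightarrow> real" where "tail n = 1 - (\<Sum>j\<le>n. p j)"

definition trunc_mean :: "nat \<Rightarrow> real" where "trunc_mean n = (\<Sum>j\<le>n. real j * p j)"

abbreviation F :: "nat \<Rightarrow> nat \<Rightarrow> real" where "F \<equiv> sum_cdf p"

lemma phi_pos: "n \<ge> 1 \<Longrightarrow> \<phi> n > 0"
  by (rule slowly_varying_step_pos[OF sv])

lemma p_nonneg: "p j \<ge> 0"
  using phi_pos[of j] by (cases "j = 0") (auto simp: p_def)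

lemma tail_diff:
  assumes "n \<le> m"
  shows "tail n - tail m = (\<Sum>j\<in>{n<..m}. p j)"
proof -
  have "(\<Sum>j\<le>m. p j) = (\<Sum>j\<le>n. p j) + (\<Sum>j\<in>{n<..m}. p j)"
    using assms by (subst sum.union_disjoint[symmetric]) (auto intro!: sum.cong)
  then show ?thesis by (simp add: tail_def)
qed

lemma tail_pos: "tail n > 0"
proof -
  have "p sums 1" using sums_one by (simp add: p_def[abs_def])
  then have "(\<Sum>j<n + 2. p j) \<le> 1"
    using sum_le_suminf[of p "{..<n + 2}"] p_nonneg by (auto simp: sums_iff)
  also have "{..<n + 2} = {..n} \<union> {Suc n}" by auto
  finally have "p (Suc n) \<le> tail n"
    by (subst (asm) sum.union_disjoint) (auto simp: tail_def)
  moreover have "p (Suc n) > 0" using phi_pos[of "Suc n"] by (simp add: p_def)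
  ultimately show ?thesis by simp
qed

lemma tail_le_one: "tail n \<le> 1"
  using sum_nonneg[of "{..n}" p] p_nonneg by (simp add: tail_def)

lemma tail_tendsto_0: "tail \<longlonglongrightarrow> 0"
proof -
  have "(\<lambda>n. \<Sum>j\<le>n. p j) \<longlonglongrightarrow> 1"
    using sums_one by (simp add: sums_def_le p_def)
  from tendsto_diff[OF tendsto_const[of 1] this] show ?thesis
    by (simp add: tail_def[abs_def])
qed

lemma eventually_comparable:
  fixes \<Lambda> :: real
  assumes "\<Lambda> \<ge> 1"
  shows "\<forall>\<^sub>F n in sequentially. \<forall>m. n \<le> m \<and> real m \<le> \<Lambda> * real n \<longrightarrow> \<phi> m \<le> 4 * \<phi> n \<and> \<phi> n \<le> 4 * \<phi> m"
  by (rule slowly_varying_step_locally_bounded[OF sv assms])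

lemma eventually_phi_le_tail_diff:
  "\<forall>\<^sub>F n in sequentially. \<phi> n / 8 \<le> tail n - tail (2 * n)"
  using eventually_comparable[of 2, simplified] eventually_ge_at_top[of 1]
proof eventually_elim
  case (elim n)
  have "\<phi> n / 8 = (\<Sum>j\<in>{n<..2*n}. \<phi> n / 4 / real (2 * n))"
    using elim by simp
  also have "\<dots> \<le> (\<Sum>j\<in>{n<..2*n}. p j)"
    unfolding p_def
  proof (intro sum_mono frac_le)
    fix j assume j: "j \<in> {n<..2*n}"
    have "\<phi> n \<le> 4 * \<phi> j" using elim j by auto
    then show "\<phi> n / 4 \<le> \<phi> j" by simp
    show "0 \<le> \<phi> j" using phi_pos[of j] j by auto
    show "0 < real j" using j by auto
    have "j \<le> 2 * n" using j by simp
    then show "real j \<le> real (2 * n)" by (simp only: of_nat_le_iff)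
  qed
  finally show ?case using tail_diff[of n "2 * n"] by simp
qed

lemma phi_tendsto_0: "\<phi> \<longlonglongrightarrow> 0"
proof (rule tendsto_sandwich)
  show "\<forall>\<^sub>F n in sequentially. 0 \<le> \<phi> n"
    using eventually_ge_at_top[of 1] by eventually_elim (use phi_pos in force)
  show "\<forall>\<^sub>F n in sequentially. \<phi> n \<le> 8 * tail n"
    using eventually_phi_le_tail_diff
  proof eventually_elim
    case (elim n)
    then show ?case using tail_pos[of "2 * n"] by simp
  qed
  show "(\<lambda>n. 8 * tail n) \<longlonglongrightarrow> 0"
    using tendsto_mult_right_zero[OF tail_tendsto_0, of 8] by simp
qed simp

text \<open>
  Each of the \<open>I\<close> dyadic blocks after \<open>n\<close> contributes at least a fixed multiple of \<open>\<phi> n\<close> to the tail,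
  and \<open>I\<close> is arbitrary.
\<close>
lemma eventually_phi_le_small_tail:
  assumes "\<epsilon> > 0"
  shows "\<forall>\<^sub>F n in sequentially. \<phi> n \<le> \<epsilon> * tail n"
proof -
  define I where "I = nat \<lceil>32 / \<epsilon>\<rceil>"
  have I: "real I \<ge> 32 / \<epsilon>" unfolding I_def by linarith
  obtain N where N: "\<And>n. n \<ge> N \<Longrightarrow> \<phi> n / 8 \<le> tail n - tail (2 * n)"
    using eventually_phi_le_tail_diff by (auto simp: eventually_sequentially)
  have "(1::real) \<le> 2 ^ I" by simp
  from eventually_comparable[OF this] eventually_ge_at_top[of "max 1 N"] show ?thesis
  proof eventually_elim
    case (elim n)
    have pos: "\<phi> n > 0" using elim phi_pos by auto
    have step: "\<phi> n / 32 \<le> tail (2 ^ i * n) - tail (2 ^ Suc i * n)" if "i < I" for i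
    proof -
      have "n \<le> 2 ^ i * n" by simp
      moreover have "(2::real) ^ i * real n \<le> 2 ^ I * real n"
        using that by (intro mult_right_mono power_increasing) auto
      ultimately have "\<phi> n \<le> 4 * \<phi> (2 ^ i * n)" using elim by auto
      moreover have "\<phi> (2 ^ i * n) / 8 \<le> tail (2 ^ i * n) - tail (2 * (2 ^ i * n))"
        using elim \<open>n \<le> 2 ^ i * n\<close> by (intro N) linarith
      ultimately show ?thesis by (simp add: mult.assoc)
    qed
    have "real I * (\<phi> n / 32) = (\<Sum>i<I. \<phi> n / 32)" by simp
    also have "\<dots> \<le> (\<Sum>i<I. tail (2 ^ i * n) - tail (2 ^ Suc i * n))"
      using step by (intro sum_mono) auto
    also have "\<dots> = tail n - tail (2 ^ I * n)"
      by (subst sum_lessThan_telescope') simp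
    also have "\<dots> \<le> tail n" using tail_pos[of "2 ^ I * n"] by simp
    finally have "real I * (\<phi> n / 32) \<le> tail n" .
    moreover have "32 / \<epsilon> * (\<phi> n / 32) \<le> real I * (\<phi> n / 32)"
      using I pos by (intro mult_right_mono) auto
    ultimately have "32 / \<epsilon> * (\<phi> n / 32) \<le> tail n" by linarith
    then have "\<epsilon> * (32 / \<epsilon> * (\<phi> n / 32)) \<le> \<epsilon> * tail n"
      using assms by (intro mult_left_mono) auto
    then show ?case using assms by simp
  qed
qed

lemma eventually_tail_diff_le_phi:
  fixes \<Lambda> :: real
  assumes "\<Lambda> \<ge> 1"
  shows "\<forall>\<^sub>F n in sequentially. \<forall>m. n \<le> m \<and> real m \<le> \<Lambda> * real n \<longrightarrow> tail n - tail m \<le> 4 * \<Lambda> * \<phi> n"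
  using eventually_comparable[OF assms] eventually_ge_at_top[of 1]
proof eventually_elim
  case (elim n)
  show ?case
  proof (intro allI impI)
    fix m assume m: "n \<le> m \<and> real m \<le> \<Lambda> * real n"
    have pos: "\<phi> n > 0" using elim phi_pos by auto
    have "tail n - tail m = (\<Sum>j\<in>{n<..m}. p j)" using m by (intro tail_diff) auto
    also have "\<dots> \<le> (\<Sum>j\<in>{n<..m}. 4 * \<phi> n / real n)"
      unfolding p_def
    proof (intro sum_mono frac_le)
      fix j assume j: "j \<in> {n<..m}"
      then have "real j \<le> real m" by simp
      then have "real j \<le> \<Lambda> * real n" using m by linarith
      then show "\<phi> j \<le> 4 * \<phi> n" using elim j by auto
    qed (use elim pos in auto)
    also have "\<dots> = real (m - n) * (4 * \<phi> n / real n)" by simp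
    also have "\<dots> \<le> \<Lambda> * real n * (4 * \<phi> n / real n)"
      using m pos by (intro mult_right_mono) auto
    also have "\<dots> = 4 * \<Lambda> * \<phi> n" using elim by simp
    finally show "tail n - tail m \<le> 4 * \<Lambda> * \<phi> n" .
  qed
qed

lemma trunc_mean_split:
  assumes "n \<le> m"
  shows "trunc_mean m = trunc_mean n + (\<Sum>j\<in>{n<..m}. \<phi> j)"
proof -
  have "(\<Sum>j\<in>{n<..m}. \<phi> j) = (\<Sum>j\<in>{n<..m}. real j * p j)"
    by (intro sum.cong) (auto simp: p_def)
  then show ?thesis
    using assms unfolding trunc_mean_def
    by (simp, subst sum.union_disjoint[symmetric]) (auto intro!: sum.cong)
qed

lemma trunc_mean_nonneg: "trunc_mean n \<ge> 0"
  unfolding trunc_mean_def by (intro sum_nonneg mult_nonneg_nonneg p_nonneg) auto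

lemma trunc_mean_mono: "n \<le> m \<Longrightarrow> trunc_mean n \<le> trunc_mean m"
  unfolding trunc_mean_def by (intro sum_mono2 mult_nonneg_nonneg p_nonneg) auto

lemma eventually_comparable_half:
  "\<forall>\<^sub>F n in sequentially. \<forall>j. n div 2 < j \<and> j \<le> n \<longrightarrow> \<phi> j \<le> 4 * \<phi> n \<and> \<phi> n \<le> 4 * \<phi> j"
proof -
  obtain N where N: "\<And>n m. n \<ge> N \<Longrightarrow> n \<le> m \<Longrightarrow> real m \<le> 2 * real n \<Longrightarrow> \<phi> m \<le> 4 * \<phi> n \<and> \<phi> n \<le> 4 * \<phi> m"
    using eventually_comparable[of 2] by (auto simp: eventually_sequentially)
  show ?thesis
    using eventually_ge_at_top[of "2 * N"]
  proof eventually_elim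
    case (elim n)
    show ?case
    proof (intro allI impI)
      fix j assume j: "n div 2 < j \<and> j \<le> n"
      then have "n \<le> 2 * j" by linarith
      then have "real n \<le> 2 * real j" by linarith
      moreover have "j \<ge> N" using elim j by linarith
      ultimately show "\<phi> j \<le> 4 * \<phi> n \<and> \<phi> n \<le> 4 * \<phi> j"
        using N[of j n] j by auto
    qed
  qed
qed

text \<open>
  The upper bound of Karamata's theorem up to a constant, by strong induction from \<open>n div 2\<close> to \<open>n\<close>: as
  \<open>\<phi> (n div 2) \<le> 3/2 \<phi> n\<close>, halving \<open>n\<close> shrinks \<open>n \<phi> n\<close> at least by the factor \<open>3/4 < 1\<close>, which leaves room
  for the sum over the last dyadic block.
\<close>
lemma trunc_mean_upper: "\<exists>K>0. \<forall>n\<ge>1. trunc_mean n \<le> K * (real n * \<phi> n)"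
proof -
  have "\<And>c::real. c > 0 \<Longrightarrow> ((\<lambda>y. step_extension \<phi> (c * y) / step_extension \<phi> y) \<longlongrightarrow> 1) at_top"
    using sv unfolding slowly_varying_def by blast
  from this[of "1/2"] have "((\<lambda>y. step_extension \<phi> (1/2 * y) / step_extension \<phi> y) \<longlongrightarrow> 1) at_top"
    by linarith
  then have "(\<lambda>n. step_extension \<phi> (1/2 * real n) / step_extension \<phi> (real n)) \<longlonglongrightarrow> 1"
    by (rule filterlim_compose) (rule filterlim_real_sequentially)
  moreover have "step_extension \<phi> (1/2 * real n) = \<phi> (n div 2)" for n
    using floor_divide_of_nat_eq[of n 2, where ?'a = real] by (simp add: step_extension_def nat_div_distrib)
  ultimately have "(\<lambda>n. \<phi> (n div 2) / \<phi> n) \<longlonglongrightarrow> 1"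
    by (simp add: step_extension_def)
  then have "\<forall>\<^sub>F n in sequentially. \<phi> (n div 2) / \<phi> n < 3 / 2"
    by (intro order_tendstoD) auto
  with eventually_comparable_half have "\<forall>\<^sub>F n in sequentially. \<phi> (n div 2) / \<phi> n < 3 / 2 \<and>
      (\<forall>j. n div 2 < j \<and> j \<le> n \<longrightarrow> \<phi> j \<le> 4 * \<phi> n)"
    by eventually_elim blast
  then obtain N where
    N: "\<And>n. n \<ge> N \<Longrightarrow> \<phi> (n div 2) / \<phi> n < 3 / 2"
       "\<And>n j. n \<ge> N \<Longrightarrow> n div 2 < j \<Longrightarrow> j \<le> n \<Longrightarrow> \<phi> j \<le> 4 * \<phi> n"
    unfolding eventually_sequentially by blast
  \<comment> \<open>\<open>16\<close> makes \<open>3/4 K + 4 \<le> K\<close>; the sum takes care of the finitely many small \<open>n\<close>.\<close>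
  define K where "K = 16 + (\<Sum>i\<in>{1..N + 1}. trunc_mean i / (real i * \<phi> i))"
  have quot_nonneg: "trunc_mean i / (real i * \<phi> i) \<ge> 0" for i
    using phi_pos[of i] trunc_mean_nonneg[of i] by (cases "i = 0") auto
  have "(\<Sum>i\<in>{1..N + 1}. trunc_mean i / (real i * \<phi> i)) \<ge> 0"
    by (intro sum_nonneg quot_nonneg)
  then have K16: "K \<ge> 16" unfolding K_def by linarith
  have "trunc_mean n \<le> K * (real n * \<phi> n)" if "n \<ge> 1" for n
    using that
  proof (induction n rule: less_induct)
    case (less n)
    have pos: "real n * \<phi> n > 0" using less.prems phi_pos[of n] by simp
    show ?case
    proof (cases "n \<le> N + 1")
      case True
      have "trunc_mean n / (real n * \<phi> n) \<le> (\<Sum>i\<in>{1..N + 1}. trunc_mean i / (real i * \<phi> i))"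
        using True less.prems quot_nonneg by (intro member_le_sum) auto
      also have "\<dots> \<le> K" by (simp add: K_def)
      finally show ?thesis using pos by (simp add: pos_divide_le_eq)
    next
      case False
      define h where "h = n div 2"
      have h: "h < n" "h \<ge> 1" "2 * real h \<le> real n" using False by (auto simp: h_def)
      have phih: "\<phi> h \<le> 3 / 2 * \<phi> n"
        using N(1)[of n] False phi_pos[of n] by (auto simp: h_def field_simps)
      have "trunc_mean n = trunc_mean h + (\<Sum>j\<in>{h<..n}. \<phi> j)"
        using h by (intro trunc_mean_split) auto
      also have "trunc_mean h \<le> K * (real h * \<phi> h)"
        using h by (intro less.IH) auto
      also have "(\<Sum>j\<in>{h<..n}. \<phi> j) \<le> (\<Sum>j\<in>{h<..n}. 4 * \<phi> n)"
        using N(2)[of n] False by (intro sum_mono) (auto simp: h_def)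
      also have "(\<Sum>j\<in>{h<..n}. 4 * \<phi> n) = real (n - h) * (4 * \<phi> n)" by simp
      also have "\<dots> \<le> real n * (4 * \<phi> n)"
        using phi_pos[of n] less.prems by (intro mult_right_mono) auto
      also have "K * (real h * \<phi> h) \<le> K * (real n / 2 * (3 / 2 * \<phi> n))"
        using h phih K16 phi_pos[of h] by (intro mult_left_mono mult_mono) auto
      finally have "trunc_mean n \<le> (3 / 4 * K + 4) * (real n * \<phi> n)"
        by (simp add: algebra_simps)
      also have "\<dots> \<le> K * (real n * \<phi> n)"
        using K16 pos by (intro mult_right_mono) auto
      finally show ?thesis .
    qed
  qed
  then show ?thesis using K16 by (intro exI[of _ K]) auto
qed

lemma eventually_trunc_mean_lower:
  "\<forall>\<^sub>F n in sequentially. real n * \<phi> n / 8 \<le> trunc_mean n"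
  using eventually_comparable_half eventually_ge_at_top[of 1]
proof eventually_elim
  case (elim n)
  have pos: "\<phi> n > 0" using elim phi_pos by auto
  have "real n * \<phi> n / 8 \<le> real (n - n div 2) * (\<phi> n / 4)"
  proof -
    have "real n / 2 \<le> real (n - n div 2)" by linarith
    then have "real n / 2 * (\<phi> n / 4) \<le> real (n - n div 2) * (\<phi> n / 4)"
      using pos by (intro mult_right_mono) auto
    then show ?thesis by simp
  qed
  also have "\<dots> = (\<Sum>j\<in>{n div 2<..n}. \<phi> n / 4)" by simp
  also have "\<dots> \<le> (\<Sum>j\<in>{n div 2<..n}. \<phi> j)"
    using elim by (intro sum_mono) auto
  also have "\<dots> \<le> trunc_mean n"
    using trunc_mean_split[of "n div 2" n] trunc_mean_nonneg[of "n div 2"] by simp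
  finally show ?case .
qed

text \<open>
  Lowering the truncation level from \<open>n\<close> to \<open>n / D\<close> divides the truncated mean by about \<open>D\<close> at the
  expense of an additional tail of order \<open>\<phi> n\<close> only.
\<close>
lemma eventually_truncation:
  assumes K: "\<forall>n\<ge>1. trunc_mean n \<le> K * (real n * \<phi> n)" "K > 0" and D: "D \<ge> 1"
  shows "\<forall>\<^sub>F n in sequentially. trunc_mean (n div D) \<le> 4 * K * real n * \<phi> n / real D \<and>
      tail (n div D) - tail n \<le> 32 * real D * \<phi> n"
proof -
  have lim: "filterlim (\<lambda>n. n div D) at_top sequentially"
    unfolding filterlim_at_top
  proof
    fix Z
    show "\<forall>\<^sub>F n in sequentially. Z \<le> n div D"
      using eventually_ge_at_top[of "Z * D"]
      by eventually_elim (use D in \<open>auto simp: less_eq_div_iff_mult_less_eq\<close>)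
  qed
  have "1 \<le> 2 * real D" using D by simp
  from eventually_compose_filterlim[OF eventually_comparable[OF this] lim]
    eventually_compose_filterlim[OF eventually_tail_diff_le_phi[OF this] lim]
    eventually_compose_filterlim[OF eventually_ge_at_top[of 1] lim] eventually_ge_at_top[of 1]
  show ?thesis
  proof eventually_elim
    case (elim n)
    define N where "N = n div D"
    have N1: "N \<ge> 1" using elim by (simp add: N_def)
    have ND: "real N \<le> real n / real D"
      unfolding N_def by (rule of_nat_div_le_of_nat)
    have nN: "N \<le> n" by (simp add: N_def)
    have nle: "real n \<le> 2 * real D * real N"
    proof -
      have "n < D * (N + 1)" unfolding N_def using D dividend_less_div_times[of D n] by (simp add: algebra_simps)
      also have "\<dots> \<le> D * (2 * N)" using N1 by (intro mult_le_mono2) simp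
      finally have "real n \<le> real (D * (2 * N))" by (simp only: of_nat_le_iff less_imp_le)
      then show ?thesis by simp
    qed
    have phiN: "\<phi> N \<le> 4 * \<phi> n" "tail N - tail n \<le> 4 * (2 * real D) * \<phi> N"
      using elim nN nle by (auto simp: N_def)
    have pos: "\<phi> n > 0" "\<phi> N > 0" using elim N1 phi_pos by auto
    have "trunc_mean N \<le> K * (real N * \<phi> N)" using K N1 by auto
    also have "\<dots> \<le> K * (real n / real D * (4 * \<phi> n))"
      using ND phiN K(2) pos by (intro mult_left_mono mult_mono) auto
    finally have A: "trunc_mean N \<le> 4 * K * real n * \<phi> n / real D"
      by (simp add: algebra_simps)
    have "tail N - tail n \<le> 4 * (2 * real D) * \<phi> N" by (rule phiN)
    also have "\<dots> \<le> 4 * (2 * real D) * (4 * \<phi> n)"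
      using phiN by (intro mult_left_mono) auto
    finally show ?case using A by (simp add: N_def)
  qed
qed

lemma laplace_partial_le:
  assumes l: "l \<ge> 0"
  shows "(\<Sum>j\<le>n. p j * exp (- l * real j)) \<le> 1 - (1 - exp (- l * real N)) * tail N"
proof -
  define m where "m = max n N"
  have "(\<Sum>j\<le>n. p j * exp (- l * real j)) \<le> (\<Sum>j\<le>m. p j * exp (- l * real j))"
    by (intro sum_mono2 mult_nonneg_nonneg p_nonneg) (auto simp: m_def)
  also have "\<dots> = (\<Sum>j\<le>N. p j * exp (- l * real j)) + (\<Sum>j\<in>{N<..m}. p j * exp (- l * real j))"
    by (subst sum.union_disjoint[symmetric]) (auto intro!: sum.cong simp: m_def)
  also have "(\<Sum>j\<le>N. p j * exp (- l * real j)) \<le> (\<Sum>j\<le>N. p j)"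
    using l p_nonneg by (intro sum_mono mult_left_le) auto
  also have "(\<Sum>j\<in>{N<..m}. p j * exp (- l * real j)) \<le> (\<Sum>j\<in>{N<..m}. p j * exp (- l * real N))"
    using l p_nonneg by (intro sum_mono mult_left_mono) (auto intro: mult_left_mono)
  also have "\<dots> = (tail N - tail m) * exp (- l * real N)"
    by (subst tail_diff) (auto simp: m_def sum_distrib_right)
  also have "\<dots> \<le> tail N * exp (- l * real N)"
    using tail_pos[of m] by (intro mult_right_mono) auto
  finally show ?thesis by (simp add: tail_def algebra_simps)
qed

end

section \<open>Bounds by truncation and by exponential moments\<close>

lemma one_minus_ge_exp:
  fixes x :: real
  assumes "0 \<le> x" "x \<le> 1/2"
  shows "exp (- ((1 + 2 * x) * x)) \<le> 1 - x"
proof -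
  have "- ((1 + 2 * x) * x) \<le> ln (1 - x)"
    using ln_one_minus_pos_lower_bound[OF assms] by (simp add: power2_eq_square algebra_simps)
  moreover have "exp (ln (1 - x)) = 1 - x" using assms by simp
  ultimately show ?thesis by (metis exp_le_cancel_iff)
qed

context slowly_varying_law
begin

text \<open>
  Chernoff's inequality with parameter \<open>1 / m\<close>. An increment above \<open>A m\<close> has weight at most
  \<open>exp (- A)\<close>, so the Laplace transform is at most about \<open>1 - r (A m)\<close>, and \<open>r (A m)\<close> is close to
  \<open>r m\<close>.
\<close>
lemma F_le_exp_tail:
  assumes \<eta>: "0 < \<eta>" "\<eta> < 1"
  shows "\<forall>\<^sub>F m in sequentially. \<forall>k n. real n \<le> 4 * (real k * (real m * \<phi> m)) \<longrightarrow>
      F k n \<le> exp (- (1 - \<eta>) * (real k * tail m))"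
proof -
  \<comment> \<open>The allowed loss \<open>\<eta>\<close> is shared equally between the factor \<open>exp (n / m)\<close>, the weight
    \<open>exp (- A)\<close> and the difference \<open>r m - r (A m)\<close>.\<close>
  define A where "A = Suc (nat \<lceil>ln (3 / \<eta>)\<rceil>)"
  have A: "real A \<ge> ln (3 / \<eta>)" "A \<ge> 1" unfolding A_def by (linarith, simp)
  have expA: "exp (- real A) \<le> \<eta> / 3"
  proof -
    have "exp (- real A) \<le> exp (- ln (3 / \<eta>))" using A by simp
    also have "\<dots> = \<eta> / 3" using \<eta> by (simp add: exp_minus)
    finally show ?thesis .
  qed
  have \<epsilon>1: "\<eta> / 12 > 0" and \<epsilon>2: "\<eta> / (12 * real A) > 0" using \<eta> A by auto
  have A1: "(1::real) \<le> real A" using A by simp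
  from eventually_phi_le_small_tail[OF \<epsilon>1] eventually_phi_le_small_tail[OF \<epsilon>2]
    eventually_tail_diff_le_phi[OF A1] eventually_ge_at_top[of 1]
  show ?thesis
  proof eventually_elim
    case (elim m)
    show ?case
    proof (intro allI impI)
      fix k n assume n: "real n \<le> 4 * (real k * (real m * \<phi> m))"
      define l where "l = 1 / real m"
      have l0: "l \<ge> 0" by (simp add: l_def)
      define G where "G = 1 - (1 - exp (- real A)) * tail (A * m)"
      have lm: "- l * real (A * m) = - real A" using elim by (simp add: l_def)
      have "F k n \<le> exp (l * real n) * G ^ k"
        using laplace_partial_le[OF l0, of _ "A * m"] l0
        unfolding lm G_def by (intro sum_cdf_chernoff p_nonneg) auto
      also have "G ^ k \<le> exp (- ((1 - exp (- real A)) * tail (A * m))) ^ k"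
      proof (rule power_mono)
        show "G \<le> exp (- ((1 - exp (- real A)) * tail (A * m)))"
          using exp_ge_add_one_self[of "- ((1 - exp (- real A)) * tail (A * m))"] by (simp add: G_def)
        have "(1 - exp (- real A)) * tail (A * m) \<le> 1 * 1"
          using tail_le_one tail_pos[of "A * m"] by (intro mult_mono) auto
        then show "0 \<le> G" by (simp add: G_def)
      qed
      also have "\<dots> = exp (- (real k * ((1 - exp (- real A)) * tail (A * m))))"
        by (simp add: exp_of_nat_mult[symmetric])
      finally have "F k n \<le> exp (l * real n) * exp (- (real k * ((1 - exp (- real A)) * tail (A * m))))"
        by simp
      then have "F k n \<le> exp (l * real n - real k * ((1 - exp (- real A)) * tail (A * m)))"
        by (simp only: exp_add[symmetric] diff_conv_add_uminus)
      moreover have "l * real n - real k * ((1 - exp (- real A)) * tail (A * m)) \<le> - (1 - \<eta>) * (real k * tail m)"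
      proof -
        have "l * real n \<le> l * (4 * (real k * (real m * \<phi> m)))"
          using n l0 by (intro mult_left_mono) auto
        also have "\<dots> = 4 * real k * \<phi> m" using elim by (simp add: l_def)
        also have "\<dots> \<le> 4 * real k * (\<eta> / 12 * tail m)"
          using elim by (intro mult_left_mono) auto
        finally have 1: "l * real n \<le> real k * (\<eta> / 3 * tail m)" by (simp add: mult_ac)
        have "tail m - tail (A * m) \<le> 4 * real A * \<phi> m"
          using elim A by simp
        also have "\<dots> \<le> 4 * real A * (\<eta> / (12 * real A) * tail m)"
          using elim by (intro mult_left_mono) auto
        also have "\<dots> = \<eta> / 3 * tail m" using A by simp
        finally have 2: "(1 - \<eta> / 3) * tail m \<le> tail (A * m)" by (simp add: algebra_simps)
        have "(1 - \<eta> / 3) * ((1 - \<eta> / 3) * tail m) \<le> (1 - exp (- real A)) * tail (A * m)"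
          using 2 expA \<eta> tail_pos[of m] by (intro mult_mono) auto
        moreover have "(1 - 2 * \<eta> / 3) * tail m \<le> (1 - \<eta> / 3) * ((1 - \<eta> / 3) * tail m)"
        proof -
          have "1 - 2 * \<eta> / 3 \<le> (1 - \<eta> / 3) * (1 - \<eta> / 3)"
            by (simp add: algebra_simps)
          then show ?thesis using tail_pos[of m] by (simp add: mult.assoc[symmetric])
        qed
        ultimately have "real k * ((1 - 2 * \<eta> / 3) * tail m) \<le> real k * ((1 - exp (- real A)) * tail (A * m))"
          by (intro mult_left_mono) auto
        with 1 show ?thesis by (simp add: algebra_simps)
      qed
      ultimately show "F k n \<le> exp (- (1 - \<eta>) * (real k * tail m))"
        by (meson exp_le_cancel_iff order_trans)
    qed
  qed
qed

text \<open>
  The condition \<open>tail N \<le> 1/2\<close> absorbs the missing factor when \<open>q\<^sup>k\<^sup>-\<^sup>1\<close> is replaced by \<open>2 q\<^sup>k\<close>.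
\<close>
lemma F_ge_truncated_power:
  assumes n: "n \<ge> 1" and half: "tail N \<le> 1 / 2" and \<theta>: "2 * real k * trunc_mean N \<le> \<theta> * real n"
  shows "(1 - \<theta>) * (1 - tail N) ^ k \<le> F k n"
proof -
  define q where "q = 1 - tail N"
  have q: "q \<ge> 1 / 2" using half by (simp add: q_def)
  have pow: "q ^ (k - 1) \<le> 2 * q ^ k" if k1: "k \<ge> 1"
  proof -
    obtain i where i: "k = Suc i" using k1 by (cases k) auto
    have "1 * q ^ i \<le> (2 * q) * q ^ i" using q by (intro mult_right_mono) auto
    then show ?thesis by (simp add: i)
  qed
  have "real k * trunc_mean N * q ^ (k - 1) \<le> real k * trunc_mean N * (2 * q ^ k)"
    using pow trunc_mean_nonneg[of N] by (cases k) (auto simp del: power_Suc intro!: mult_left_mono)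
  also have "\<dots> = (2 * real k * trunc_mean N) * q ^ k" by simp
  also have "\<dots> \<le> \<theta> * real n * q ^ k" using \<theta> q by (intro mult_right_mono) auto
  finally have "real k * trunc_mean N * q ^ (k - 1) \<le> \<theta> * real n * q ^ k" .
  moreover have "real n * q ^ k - real k * trunc_mean N * q ^ (k - 1) \<le> real n * F k n"
    by (rule sum_cdf_truncated_markov[OF p_nonneg]) (auto simp: q_def tail_def trunc_mean_def)
  ultimately have "real n * ((1 - \<theta>) * q ^ k) \<le> real n * F k n" by (simp add: algebra_simps)
  then show ?thesis using n by (simp add: q_def)
qed

text \<open>
  Truncation at \<open>m / D\<close>, where \<open>D\<close> is so large that the truncated sum is at most \<open>n\<close> with conditional
  probability at least \<open>1/2\<close>. Then \<open>(1 - r (m / D))\<^sup>k\<close> is close to \<open>exp (- k r m)\<close> on the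
  exponential scale, since \<open>r (m / D)\<close> tends to \<open>0\<close> and is close to \<open>r m\<close>.
\<close>
lemma F_ge_exp_tail:
  assumes \<eta>: "0 < \<eta>" "\<eta> < 1"
  shows "\<forall>\<^sub>F m in sequentially. \<forall>k n. 1 \<le> k \<and> real k * (real m * \<phi> m) \<le> 4 * real n \<longrightarrow>
      exp (- (1 + \<eta>) * (real k * tail m)) / 2 \<le> F k n"
proof -
  obtain K where K: "K > 0" "\<forall>n\<ge>1. trunc_mean n \<le> K * (real n * \<phi> n)"
    using trunc_mean_upper by blast
  \<comment> \<open>This makes the Markov bound \<open>32 K / D\<close> below at most \<open>1/2\<close>.\<close>
  define D where "D = Suc (nat \<lceil>64 * K\<rceil>)"
  have D: "D \<ge> 1" "real D \<ge> 64 * K" unfolding D_def by (simp, linarith)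
  have \<epsilon>: "\<eta> / (96 * real D) > 0" using \<eta> D by simp
  have "\<eta> / 12 > 0" using \<eta> by simp
  then have small: "\<forall>\<^sub>F m in sequentially. tail m < \<eta> / 12"
    by (rule order_tendstoD(2)[OF tail_tendsto_0])
  from eventually_truncation[OF K(2,1) D(1)] eventually_phi_le_small_tail[OF \<epsilon>] small eventually_ge_at_top[of 1]
  show ?thesis
  proof eventually_elim
    case (elim m)
    define N where "N = m div D"
    have pos: "\<phi> m > 0" using elim phi_pos by auto
    have tN: "tail N \<le> (1 + \<eta> / 3) * tail m"
    proof -
      have "tail N - tail m \<le> 32 * real D * \<phi> m" using elim by (simp add: N_def)
      also have "\<dots> \<le> 32 * real D * (\<eta> / (96 * real D) * tail m)"
        using elim by (intro mult_left_mono) auto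
      also have "\<dots> = \<eta> / 3 * tail m" using D by simp
      finally show ?thesis by (simp add: algebra_simps)
    qed
    have "(1 + \<eta> / 3) * tail m \<le> 2 * (\<eta> / 12)"
      using elim \<eta> tail_pos[of m] by (intro mult_mono) auto
    with tN have tN2: "tail N \<le> \<eta> / 6" by simp
    show ?case
    proof (intro allI impI)
      fix k n assume kn: "1 \<le> k \<and> real k * (real m * \<phi> m) \<le> 4 * real n"
      have n1: "n \<ge> 1"
      proof (rule ccontr)
        assume "\<not> n \<ge> 1"
        then have "real k * (real m * \<phi> m) \<le> 0" using kn by simp
        moreover have "real k * (real m * \<phi> m) > 0" using kn elim pos by simp
        ultimately show False by linarith
      qed
      have "2 * real k * trunc_mean N \<le> 2 * real k * (4 * K * real m * \<phi> m / real D)"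
        using elim by (intro mult_left_mono) (auto simp: N_def)
      also have "\<dots> = 8 * K / real D * (real k * (real m * \<phi> m))" by simp
      also have "\<dots> \<le> 8 * K / real D * (4 * real n)"
        using kn K D by (intro mult_left_mono) auto
      also have "\<dots> = (32 * K / real D) * real n" by simp
      also have "\<dots> \<le> 1 / 2 * real n"
        using D K by (intro mult_right_mono) (auto simp: field_simps)
      finally have "(1 - 1 / 2) * (1 - tail N) ^ k \<le> F k n"
        using tN2 \<eta> n1 by (intro F_ge_truncated_power) auto
      then have "(1 - tail N) ^ k / 2 \<le> F k n" by simp
      moreover have "exp (- (1 + \<eta>) * (real k * tail m)) \<le> (1 - tail N) ^ k"
      proof -
        have "(1 + 2 * tail N) * tail N \<le> (1 + \<eta> / 3) * ((1 + \<eta> / 3) * tail m)"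
          using tN tN2 tail_pos[of N] \<eta> by (intro mult_mono) auto
        also have "\<dots> \<le> (1 + \<eta>) * tail m"
        proof -
          have "\<eta> * \<eta> \<le> 1 * \<eta>" using \<eta> by (intro mult_right_mono) auto
          moreover have "(1 + \<eta> / 3) * (1 + \<eta> / 3) = 1 + 2 * \<eta> / 3 + \<eta> * \<eta> / 9"
            by (simp add: algebra_simps)
          ultimately have "(1 + \<eta> / 3) * (1 + \<eta> / 3) \<le> 1 + \<eta>"
            using \<eta> by linarith
          then show ?thesis using tail_pos[of m] by (simp add: mult.assoc[symmetric])
        qed
        finally have "exp (- ((1 + \<eta>) * tail m)) \<le> exp (- ((1 + 2 * tail N) * tail N))"
          by simp
        also have "\<dots> \<le> 1 - tail N"
          using tN2 \<eta> tail_pos[of N] by (intro one_minus_ge_exp) auto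
        finally have "exp (- ((1 + \<eta>) * tail m)) ^ k \<le> (1 - tail N) ^ k"
          by (intro power_mono) auto
        then show ?thesis by (simp add: exp_of_nat_mult[symmetric] algebra_simps)
      qed
      ultimately show "exp (- (1 + \<eta>) * (real k * tail m)) / 2 \<le> F k n"
        by (meson divide_right_mono order_trans zero_le_numeral)
    qed
  qed
qed

text \<open>
  Here the level is \<open>n / D\<close> and the result is compared with \<open>(1 - r n)\<^sup>k\<close> itself rather than on the
  exponential scale: the loss per increment is \<open>O(D \<phi> n)\<close>, hence \<open>O(D C)\<close> in total.
\<close>
lemma F_ge_max_power:
  assumes K: "\<forall>n\<ge>1. trunc_mean n \<le> K * (real n * \<phi> n)" "K > 0"
    and D: "D \<ge> 1" and C: "C > 0" "8 * K * C \<le> real D"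
  shows "\<forall>\<^sub>F n in sequentially. \<forall>k. real k * \<phi> n \<le> C \<longrightarrow>
      (1 - 8 * K * C / real D) * exp (- (128 * real D * C)) * (1 - tail n) ^ k \<le> F k n"
proof -
  have "1 / (128 * real D) > 0" using D by simp
  then have small_phi: "\<forall>\<^sub>F n in sequentially. \<phi> n < 1 / (128 * real D)"
    by (rule order_tendstoD(2)[OF phi_tendsto_0])
  have small_tail: "\<forall>\<^sub>F n in sequentially. tail n < 1 / 4"
    by (rule order_tendstoD(2)[OF tail_tendsto_0]) simp
  from eventually_truncation[OF K D] small_phi small_tail eventually_ge_at_top[of 1]
  show ?thesis
  proof eventually_elim
    case (elim n)
    define N where "N = n div D"
    define x where "x = 64 * real D * \<phi> n"
    have pos: "\<phi> n > 0" using elim phi_pos by auto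
    have x: "0 \<le> x" "x \<le> 1 / 2" using pos elim D by (auto simp: x_def field_simps)
    have tN: "tail N - tail n \<le> x / 2" using elim by (simp add: N_def x_def)
    show ?case
    proof (intro allI impI)
      fix k assume k: "real k * \<phi> n \<le> C"
      have "2 * real k * trunc_mean N \<le> 2 * real k * (4 * K * real n * \<phi> n / real D)"
        using elim by (intro mult_left_mono) (auto simp: N_def)
      also have "\<dots> = 8 * K / real D * real n * (real k * \<phi> n)" by simp
      also have "\<dots> \<le> 8 * K / real D * real n * C"
        using k K by (intro mult_left_mono) auto
      also have "\<dots> = (8 * K * C / real D) * real n" by simp
      finally have "(1 - 8 * K * C / real D) * (1 - tail N) ^ k \<le> F k n"
        using elim tN x by (intro F_ge_truncated_power) auto
      moreover have "exp (- (128 * real D * C)) * (1 - tail n) ^ k \<le> (1 - tail N) ^ k"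
      proof -
        have "(1 + 2 * x) * x \<le> 2 * x" using x by (intro mult_right_mono) auto
        then have "exp (- 2 * x) \<le> exp (- ((1 + 2 * x) * x))" by simp
        also have "\<dots> \<le> 1 - x" by (rule one_minus_ge_exp[OF x])
        finally have e: "exp (- 2 * x) \<le> 1 - x" .
        have "exp (- 2 * x) * (1 - tail n) \<le> (1 - x) * (1 - tail n)"
          using e elim by (intro mult_right_mono) auto
        also have "\<dots> \<le> 1 - tail N"
        proof -
          have "x * (1 / 2) \<le> x * (1 - tail n)" using x elim by (intro mult_left_mono) auto
          then show ?thesis using tN by (simp add: algebra_simps)
        qed
        finally have "(exp (- 2 * x) * (1 - tail n)) ^ k \<le> (1 - tail N) ^ k"
          using elim by (intro power_mono) auto
        moreover have "exp (- (128 * real D * C)) \<le> exp (- 2 * x) ^ k"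
        proof -
          have "128 * real D * (real k * \<phi> n) \<le> 128 * real D * C"
            using k by (intro mult_left_mono) auto
          then show ?thesis by (simp add: exp_of_nat_mult[symmetric] x_def algebra_simps)
        qed
        then have "exp (- (128 * real D * C)) * (1 - tail n) ^ k \<le> exp (- 2 * x) ^ k * (1 - tail n) ^ k"
          using elim by (intro mult_right_mono) auto
        ultimately show ?thesis by (simp add: power_mult_distrib)
      qed
      moreover have "1 - 8 * K * C / real D \<ge> 0" using C D by (simp add: field_simps)
      ultimately show "(1 - 8 * K * C / real D) * exp (- (128 * real D * C)) * (1 - tail n) ^ k \<le> F k n"
        unfolding mult.assoc[of _ "exp _"] by (meson mult_left_mono order_trans)
    qed
  qed
qed

text \<open>
  For small \<open>C\<close> the choice below is \<open>D C = 1\<close>, that is, truncation at \<open>n\<close> itself, and both factors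
  of \<open>a C\<close> tend to \<open>1\<close>; for large \<open>C\<close> the level is lowered to keep the first factor at least \<open>1/2\<close>.
\<close>
lemma F_ge_max_power_function:
  "\<exists>a :: real \<Rightarrow> real. (\<forall>C>0. a C > 0) \<and> (a \<longlongrightarrow> 1) (at_right 0) \<and>
     (\<forall>C>0. \<forall>\<^sub>F n in sequentially. \<forall>k. real k * \<phi> n \<le> C \<longrightarrow> a C * (1 - tail n) ^ k \<le> F k n)"
proof -
  obtain K where K: "K > 0" "\<forall>n\<ge>1. trunc_mean n \<le> K * (real n * \<phi> n)"
    using trunc_mean_upper by blast
  define D where "D C = nat \<lceil>16 * K * C\<rceil>" for C
  define a where "a C = (1 - 8 * K * C / real (D C)) * exp (- (128 * real (D C) * C))" for C
  have D: "D C \<ge> 1" "16 * K * C \<le> real (D C)" if "C > 0" for C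
  proof -
    have "16 * K * C > 0" using K that by simp
    then show "D C \<ge> 1" "16 * K * C \<le> real (D C)" unfolding D_def by linarith+
  qed
  show ?thesis
  proof (intro exI[of _ a] conjI allI impI)
    fix C :: real assume C: "C > 0"
    have "8 * K * C / real (D C) < 1"
    proof -
      have "8 * K * C < 16 * K * C" using K C by simp
      then show ?thesis using D[OF C] by simp
    qed
    then show "a C > 0" by (simp add: a_def)
    have "8 * K * C \<le> real (D C)"
    proof -
      have "8 * K * C \<le> 16 * K * C" using K C by simp
      then show ?thesis using D[OF C] by linarith
    qed
    from F_ge_max_power[OF K(2,1) D(1)[OF C] C this]
    show "\<forall>\<^sub>F n in sequentially. \<forall>k. real k * \<phi> n \<le> C \<longrightarrow> a C * (1 - tail n) ^ k \<le> F k n"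
      by (simp add: a_def)
  next
    have "\<forall>\<^sub>F C in at_right 0. (1 - 8 * K * C) * exp (- (128 * C)) = a C"
    proof -
      have "1 / (16 * K) > 0" using K by simp
      then have "\<forall>\<^sub>F C in at_right 0. C \<in> {0<..<1 / (16 * K)}"
        by (rule eventually_at_right_real)
      then show ?thesis
      proof eventually_elim
        case (elim C)
        then have "0 < 16 * K * C" "16 * K * C < 1" using K by (auto simp: field_simps)
        then have "D C = 1" unfolding D_def by linarith
        then show ?case by (simp add: a_def)
      qed
    qed
    moreover have "((\<lambda>C. (1 - 8 * K * C) * exp (- (128 * C))) \<longlongrightarrow> (1 - 8 * K * 0) * exp (- (128 * 0))) (at_right 0)"
      by (intro tendsto_intros)
    ultimately have "(a \<longlongrightarrow> (1 - 8 * K * 0) * exp (- (128 * 0))) (at_right 0)"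
      by (simp cong: tendsto_cong)
    then show "(a \<longlongrightarrow> 1) (at_right 0)" by simp
  qed
qed

end

section \<open>Truncation at a conjugate level, and the rate function\<close>

text \<open>Fekete's lemma for nonnegative sequences.\<close>
lemma subadditive_quotient_convergent:
  fixes a :: "nat \<Rightarrow> real"
  assumes sub: "\<And>k l. a (k + l) \<le> a k + a l" and nonneg: "\<And>k. a k \<ge> 0"
  shows "convergent (\<lambda>k. a k / real k)"
proof -
  define L where "L = (INF k\<in>{1..}. a k / real k)"
  have bdd: "bdd_below ((\<lambda>k. a k / real k) ` {1..})"
    using nonneg by (intro bdd_belowI[of _ 0]) auto
  have mult: "a (q * k + r) \<le> real q * a k + a r" for q k r
  proof (induction q)
    case (Suc q)
    have "a (Suc q * k + r) \<le> a k + a (q * k + r)"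
      using sub[of k "q * k + r"] by (simp add: add.assoc)
    with Suc show ?case by (simp add: algebra_simps)
  qed simp
  have "(\<lambda>k. a k / real k) \<longlonglongrightarrow> L"
  proof (rule order_tendstoI)
    fix y assume "y < L"
    show "\<forall>\<^sub>F n in sequentially. y < a n / real n"
      using eventually_ge_at_top[of 1]
    proof eventually_elim
      case (elim n)
      then have "L \<le> a n / real n" unfolding L_def using bdd by (intro cINF_lower) auto
      with \<open>y < L\<close> show ?case by simp
    qed
  next
    fix y assume "L < y"
    then obtain k where k: "k \<ge> 1" "a k / real k < y"
      unfolding L_def using bdd by (subst (asm) cINF_less_iff) auto
    define B where "B = (\<Sum>r<k. a r)"
    have "(\<lambda>n. a k / real k + B / real n) \<longlonglongrightarrow> a k / real k + 0"
      by (intro tendsto_intros lim_const_over_n)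
    then have "\<forall>\<^sub>F n in sequentially. a k / real k + B / real n < y"
      using k by (intro order_tendstoD) auto
    then show "\<forall>\<^sub>F n in sequentially. a n / real n < y"
      using eventually_ge_at_top[of 1]
    proof eventually_elim
      case (elim n)
      have "a n \<le> real (n div k) * a k + a (n mod k)"
        using mult[of "n div k" k "n mod k"] by simp
      also have "a (n mod k) \<le> B"
        unfolding B_def using k nonneg by (intro member_le_sum) auto
      also have "real (n div k) * a k \<le> real n / real k * a k"
        using nonneg of_nat_div_le_of_nat[of n k, where ?'a = real] by (intro mult_right_mono) auto
      finally have "a n / real n \<le> (real n / real k * a k + B) / real n"
        by (intro divide_right_mono) auto
      also have "\<dots> = a k / real k + B / real n"
        using elim by (simp add: add_divide_distrib)
      finally show ?case using elim by simp
    qed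
  qed
  then show ?thesis by (rule convergentI)
qed

lemma nat_floor_between:
  fixes y :: real
  assumes "1 \<le> y"
  shows "1 \<le> nat \<lfloor>y\<rfloor>" "real (nat \<lfloor>y\<rfloor>) \<le> y" "y \<le> 2 * real (nat \<lfloor>y\<rfloor>)"
proof -
  have "1 \<le> \<lfloor>y\<rfloor>" using assms by simp
  moreover from this have "real (nat \<lfloor>y\<rfloor>) = of_int \<lfloor>y\<rfloor>" by simp
  moreover have "y < of_int \<lfloor>y\<rfloor> + 1" "of_int \<lfloor>y\<rfloor> \<le> y" by linarith+
  ultimately show "1 \<le> nat \<lfloor>y\<rfloor>" "real (nat \<lfloor>y\<rfloor>) \<le> y" "y \<le> 2 * real (nat \<lfloor>y\<rfloor>)"
    by linarith+
qed

lemma ln_between_exponents: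
  fixes x :: real
  assumes "x > 0" "exp (- u) / 2 \<le> x" "x \<le> exp (- v)"
  shows "v \<le> - ln x" "- ln x \<le> u + ln 2"
proof -
  have "ln x \<le> ln (exp (- v))" using assms by (subst ln_le_cancel_iff) auto
  then show "v \<le> - ln x" by simp
  have "ln (exp (- u) / 2) \<le> ln x" using assms by (subst ln_le_cancel_iff) auto
  then show "- ln x \<le> u + ln 2" by (simp add: ln_div)
qed

context slowly_varying_law
begin

lemma F_pos: "k \<le> n \<Longrightarrow> F k n > 0"
proof -
  assume "k \<le> n"
  then have "p 1 ^ k \<le> F k n" by (rule sum_cdf_ge_power[OF p_nonneg])
  moreover have "p 1 > 0" using phi_pos[of 1] by (simp add: p_def)
  then have "p 1 ^ k > 0" by simp
  ultimately show ?thesis by linarith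
qed

lemma F_le_1: "F k n \<le> 1"
proof -
  have "F k n \<le> (1 - tail n) ^ k"
    using sum_cdf_le_power[OF p_nonneg] by (simp add: tail_def)
  also have "\<dots> \<le> 1" using tail_pos[of n] tail_le_one[of n] by (intro power_le_one) auto
  finally show ?thesis .
qed

text \<open>
  A solution of \<open>m \<phi> m \<approx> x\<close> up to constant factors, which is all that the bounds require. The
  constants are those that result from rounding \<open>x \<phi>\<^sup>* x\<close> down.
\<close>
definition truncation_level :: "(real \<Rightarrow> nat) \<Rightarrow> bool" where
  "truncation_level m \<longleftrightarrow> filterlim m at_top at_top \<and>
     (\<forall>\<^sub>F x in at_top. x \<le> 4 * (real (m x) * \<phi> (m x)) \<and> real (m x) * \<phi> (m x) \<le> 2 * x)"

text \<open>
  The conjugacy relation \<open>f (g x) \<sim> x\<close> is the equation for the level. As \<open>f\<close> is bounded on bounded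
  intervals, it also forces \<open>g x \<rightarrow> \<infinity>\<close>, so that rounding \<open>g x\<close> down costs at most a factor \<open>2\<close>.
\<close>
lemma truncation_level_conjugate:
  assumes "conjugate_slowly_varying (step_extension \<phi>) \<phi>'"
  shows "truncation_level (\<lambda>x. nat \<lfloor>x * \<phi>' x\<rfloor>)"
proof -
  define f where "f y = y * step_extension \<phi> y" for y
  define g where "g x = x * \<phi>' x" for x
  have g_pos: "g x > 0" if "x \<ge> 1" for x
    using assms that by (auto simp: conjugate_slowly_varying_def slowly_varying_def g_def)
  have "(\<lambda>x. f (g x)) \<sim>[at_top] (\<lambda>x. x)"
    using assms by (simp add: conjugate_slowly_varying_def f_def g_def)
  then have "((\<lambda>x. f (g x) / x) \<longlongrightarrow> 1) at_top"
  proof (rule asymp_equivD_strong)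
    show "\<forall>\<^sub>F x in at_top. f (g x) \<noteq> 0 \<or> x \<noteq> 0"
      using eventually_gt_at_top[of "0::real"] by eventually_elim simp
  qed
  then have "\<forall>\<^sub>F x in at_top. 1 / 2 < f (g x) / x \<and> f (g x) / x < 2 \<and> x \<ge> 1"
    by (intro eventually_conj order_tendstoD eventually_ge_at_top) auto
  then have fg: "\<forall>\<^sub>F x in at_top. x / 2 < f (g x) \<and> f (g x) < 2 * x \<and> x \<ge> 1"
    by eventually_elim (auto simp: field_simps)
  have g_large: "\<forall>\<^sub>F x in at_top. real Z \<le> g x" for Z
  proof -
    define B where "B = real Z * (\<Sum>i\<le>Z. \<bar>\<phi> i\<bar>)"
    show ?thesis
      using fg eventually_ge_at_top[of "2 * B"]
    proof eventually_elim
      case (elim x)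
      show ?case
      proof (rule ccontr)
        assume "\<not> real Z \<le> g x"
        then have gx: "0 < g x" "g x < real Z" using g_pos[of x] elim by auto
        then have "nat \<lfloor>g x\<rfloor> \<le> Z" by linarith
        then have "\<bar>\<phi> (nat \<lfloor>g x\<rfloor>)\<bar> \<le> (\<Sum>i\<le>Z. \<bar>\<phi> i\<bar>)"
          by (intro member_le_sum) auto
        then have "g x * \<bar>\<phi> (nat \<lfloor>g x\<rfloor>)\<bar> \<le> B"
          unfolding B_def using gx by (intro mult_mono) auto
        moreover have "f (g x) \<le> g x * \<bar>\<phi> (nat \<lfloor>g x\<rfloor>)\<bar>"
          using gx by (auto simp: f_def step_extension_def intro!: mult_left_mono)
        ultimately show False using elim by linarith
      qed
    qed
  qed
  have "filterlim (\<lambda>x. nat \<lfloor>g x\<rfloor>) at_top at_top"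
    unfolding filterlim_at_top
  proof
    fix Z
    show "\<forall>\<^sub>F x in at_top. Z \<le> nat \<lfloor>g x\<rfloor>"
      using g_large[of Z] by eventually_elim linarith
  qed
  moreover have "\<forall>\<^sub>F x in at_top. x \<le> 4 * (real (nat \<lfloor>g x\<rfloor>) * \<phi> (nat \<lfloor>g x\<rfloor>)) \<and>
      real (nat \<lfloor>g x\<rfloor>) * \<phi> (nat \<lfloor>g x\<rfloor>) \<le> 2 * x"
    using fg g_large[of 1]
  proof eventually_elim
    case (elim x)
    define m where "m = nat \<lfloor>g x\<rfloor>"
    have m: "m \<ge> 1" "real m \<le> g x" "g x \<le> 2 * real m"
      using elim nat_floor_between[of "g x"] unfolding m_def by auto
    have pos: "\<phi> m > 0" using m phi_pos by auto
    have f: "f (g x) = g x * \<phi> m" by (simp add: f_def step_extension_def m_def)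
    have "real m * \<phi> m \<le> g x * \<phi> m" using m pos by (intro mult_right_mono) auto
    moreover have "g x * \<phi> m \<le> 2 * real m * \<phi> m" using m pos by (intro mult_right_mono) auto
    ultimately show ?case using elim f unfolding m_def[symmetric] by linarith
  qed
  ultimately show ?thesis
    unfolding truncation_level_def g_def by blast
qed

text \<open>
  The level depends on \<open>b\<close> alone, so the bounds are uniform in \<open>k\<close>. Here \<open>n\<close> stands for \<open>\<lfloor>b k\<rfloor>\<close>,
  which is at least half of \<open>b k\<close>.
\<close>
lemma F_bounds_at_truncation_level:
  assumes m: "truncation_level m" and \<eta>: "0 < \<eta>" "\<eta> < 1"
  shows "\<forall>\<^sub>F b in at_top. \<forall>k n. 1 \<le> k \<and> real n \<le> b * real k \<and> b * real k \<le> 2 * real n \<longrightarrow>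
      exp (- (1 + \<eta>) * (real k * tail (m b))) / 2 \<le> F k n \<and>
      F k n \<le> exp (- (1 - \<eta>) * (real k * tail (m b)))"
proof -
  have lim: "filterlim m at_top at_top"
    and cmp: "\<forall>\<^sub>F x in at_top. x \<le> 4 * (real (m x) * \<phi> (m x)) \<and> real (m x) * \<phi> (m x) \<le> 2 * x"
    using m by (auto simp: truncation_level_def)
  from eventually_compose_filterlim[OF F_le_exp_tail[OF \<eta>] lim]
    eventually_compose_filterlim[OF F_ge_exp_tail[OF \<eta>] lim] cmp
  show ?thesis
  proof eventually_elim
    case (elim b)
    show ?case
    proof (intro allI impI)
      fix k n assume kn: "1 \<le> k \<and> real n \<le> b * real k \<and> b * real k \<le> 2 * real n"
      define y where "y = real (m b) * \<phi> (m b)"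
      have "real k * b \<le> real k * (4 * y)" "real k * y \<le> real k * (2 * b)"
        using elim kn by (auto intro!: mult_left_mono simp: y_def)
      then have "real n \<le> 4 * (real k * y)" "real k * y \<le> 4 * real n"
        using kn mult.commute[of b "real k"] by linarith+
      with elim kn show "exp (- (1 + \<eta>) * (real k * tail (m b))) / 2 \<le> F k n \<and>
          F k n \<le> exp (- (1 - \<eta>) * (real k * tail (m b)))"
        unfolding y_def by blast
    qed
  qed
qed

text \<open>
  The exponent of (ii) diverges. If the level \<open>m\<close> is at most \<open>n\<close>, then \<open>m \<phi> m \<approx> n / k\<close> makes
  \<open>k \<phi> m\<close> bounded below, and \<open>r m\<close> is much larger than \<open>\<phi> m\<close>. A level above \<open>n\<close> is impossible: as
  the truncated mean is monotone, \<open>n \<phi> n = O(S n) = O(S m) = O(m \<phi> m) = O(n / k)\<close>, contradicting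
  \<open>k \<phi> n \<rightarrow> \<infinity>\<close>.
\<close>
lemma filterlim_tail_at_truncation_level:
  fixes k n :: "nat \<Rightarrow> nat"
  assumes m: "truncation_level m"
    and n: "filterlim n at_top sequentially" and k: "\<And>j. 1 \<le> k j"
    and kphi: "filterlim (\<lambda>j. real (k j) * \<phi> (n j)) at_top sequentially"
    and nk: "filterlim (\<lambda>j. real (n j) / real (k j)) at_top sequentially"
  shows "filterlim (\<lambda>j. real (k j) * tail (m (real (n j) / real (k j)))) at_top sequentially"
  unfolding filterlim_at_top_gt[where c = 0]
proof (intro allI impI)
  fix Z :: real assume Z: "Z > 0"
  obtain K where K: "K > 0" "\<forall>n\<ge>1. trunc_mean n \<le> K * (real n * \<phi> n)"
    using trunc_mean_upper by blast
  have cmp: "\<forall>\<^sub>F x in at_top. x \<le> 4 * (real (m x) * \<phi> (m x)) \<and> real (m x) * \<phi> (m x) \<le> 2 * x"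
    and lim: "filterlim m at_top at_top"
    using m by (auto simp: truncation_level_def)
  have lim': "filterlim (\<lambda>j. m (real (n j) / real (k j))) at_top sequentially"
    by (rule filterlim_compose[OF lim nk])
  have "1 / (4 * Z) > 0" using Z by simp
  from eventually_compose_filterlim[OF eventually_phi_le_small_tail[OF this] lim']
    eventually_compose_filterlim[OF cmp nk]
    eventually_compose_filterlim[OF eventually_trunc_mean_lower n]
    eventually_compose_filterlim[OF eventually_ge_at_top[of 1] n]
    eventually_compose_filterlim[OF eventually_gt_at_top[of "16 * K"] kphi]
  show "\<forall>\<^sub>F j in sequentially. Z \<le> real (k j) * tail (m (real (n j) / real (k j)))"
  proof eventually_elim
    case (elim j)
    define x where "x = real (n j) / real (k j)"
    have kj: "real (k j) > 0" using k[of j] by simp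
    have xk: "real (k j) * x = real (n j)" using kj by (simp add: x_def)
    have mn: "m x \<le> n j"
    proof (rule ccontr)
      assume less: "\<not> m x \<le> n j"
      have "real (n j) * \<phi> (n j) / 8 \<le> trunc_mean (n j)" using elim by simp
      also have "\<dots> \<le> trunc_mean (m x)" using less by (intro trunc_mean_mono) auto
      also have "\<dots> \<le> K * (real (m x) * \<phi> (m x))" using K less by auto
      also have "\<dots> \<le> K * (2 * x)" using K elim by (intro mult_left_mono) (auto simp: x_def)
      finally have "real (k j) * (real (n j) * \<phi> (n j) / 8) \<le> real (k j) * (K * (2 * x))"
        using kj by (intro mult_left_mono) auto
      also have "\<dots> = 2 * K * real (n j)" using xk by (simp add: mult_ac)
      finally have "real (n j) * (real (k j) * \<phi> (n j)) \<le> real (n j) * (16 * K)"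
        by (simp add: mult_ac)
      then have "real (k j) * \<phi> (n j) \<le> 16 * K" using elim by simp
      then show False using elim by linarith
    qed
    have x4: "x \<le> 4 * (real (m x) * \<phi> (m x))" using elim by (simp add: x_def)
    have "real (n j) \<le> 4 * (real (m x) * (real (k j) * \<phi> (m x)))"
    proof -
      have "real (k j) * x \<le> real (k j) * (4 * (real (m x) * \<phi> (m x)))"
        using x4 kj by (intro mult_left_mono) auto
      then show ?thesis unfolding xk by (simp only: mult_ac)
    qed
    also have "\<dots> \<le> 4 * (real (n j) * (real (k j) * \<phi> (m x)))"
    proof -
      have "x > 0" using elim kj by (simp add: x_def)
      with x4 have "real (m x) * \<phi> (m x) > 0" by linarith
      then have "\<phi> (m x) \<ge> 0" by (simp add: zero_less_mult_iff)
      then show ?thesis using mn kj by (intro mult_left_mono mult_right_mono) auto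
    qed
    finally have "1 \<le> 4 * (real (k j) * \<phi> (m x))" using elim by simp
    also have "\<dots> \<le> 4 * (real (k j) * (1 / (4 * Z) * tail (m x)))"
      using elim kj by (intro mult_left_mono) (auto simp: x_def)
    finally show ?case using Z by (simp add: x_def field_simps)
  qed
qed

lemma F_eq_exp_tail:
  fixes k n :: "nat \<Rightarrow> nat"
  assumes m: "truncation_level m" and kn: "\<And>j. 1 \<le> k j \<and> k j \<le> n j"
    and n: "filterlim n at_top sequentially"
    and kphi: "filterlim (\<lambda>j. real (k j) * \<phi> (n j)) at_top sequentially"
    and nk: "filterlim (\<lambda>j. real (n j) / real (k j)) at_top sequentially"
  shows "\<exists>\<epsilon>. \<epsilon> \<longlonglongrightarrow> 0 \<and> (\<forall>j. F (k j) (n j) =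
      exp (- ((1 + \<epsilon> j) * real (k j) * tail (m (real (n j) / real (k j))))))"
proof -
  define X where "X j = real (k j) * tail (m (real (n j) / real (k j)))" for j
  define \<epsilon> where "\<epsilon> j = - ln (F (k j) (n j)) / X j - 1" for j
  have X_pos: "X j > 0" for j using kn[of j] tail_pos by (simp add: X_def)
  have F_pos': "F (k j) (n j) > 0" for j using kn[of j] F_pos by blast
  have X_lim: "filterlim X at_top sequentially"
    unfolding X_def[abs_def] using kn by (intro filterlim_tail_at_truncation_level m n kphi nk) auto
  have "\<epsilon> \<longlonglongrightarrow> 0"
  proof (rule tendstoI)
    fix e :: real assume e: "e > 0"
    define \<eta> where "\<eta> = min (e / 2) (1 / 2)"
    have \<eta>: "0 < \<eta>" "\<eta> < 1" "2 * \<eta> \<le> e" using e by (auto simp: \<eta>_def)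
    from eventually_compose_filterlim[OF F_bounds_at_truncation_level[OF m \<eta>(1,2)] nk]
      eventually_compose_filterlim[OF eventually_gt_at_top[of "ln 2 / \<eta>"] X_lim]
    show "\<forall>\<^sub>F j in sequentially. dist (\<epsilon> j) 0 < e"
    proof eventually_elim
      case (elim j)
      have kj: "real (k j) > 0" using kn[of j] by simp
      have "exp (- (1 + \<eta>) * X j) / 2 \<le> F (k j) (n j) \<and> F (k j) (n j) \<le> exp (- (1 - \<eta>) * X j)"
        using elim(1)[rule_format, of "k j" "n j"] kn[of j] kj by (simp add: X_def)
      then have "(1 - \<eta>) * X j \<le> - ln (F (k j) (n j))" "- ln (F (k j) (n j)) \<le> (1 + \<eta>) * X j + ln 2"
        unfolding mult_minus_left using ln_between_exponents[OF F_pos'] by blast+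
      moreover have "ln 2 < \<eta> * X j" using elim(2) \<eta> by (simp add: field_simps)
      ultimately have "(1 - \<eta>) * X j \<le> - ln (F (k j) (n j))" "- ln (F (k j) (n j)) < (1 + 2 * \<eta>) * X j"
        by (auto simp: algebra_simps)
      then have "1 - \<eta> \<le> - ln (F (k j) (n j)) / X j" "- ln (F (k j) (n j)) / X j < 1 + 2 * \<eta>"
        using X_pos[of j] by (simp_all only: pos_le_divide_eq pos_divide_less_eq)
      then show ?case using \<eta> by (simp add: \<epsilon>_def dist_real_def abs_less_iff)
    qed
  qed
  moreover have "F (k j) (n j) = exp (- ((1 + \<epsilon> j) * real (k j) * tail (m (real (n j) / real (k j)))))" for j
  proof -
    have "(1 + \<epsilon> j) * real (k j) * tail (m (real (n j) / real (k j))) = (1 + \<epsilon> j) * X j"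
      by (simp add: X_def mult.assoc)
    also have "\<dots> = - ln (F (k j) (n j))" using X_pos[of j] by (simp add: \<epsilon>_def)
    finally show ?thesis using F_pos'[of j] by simp
  qed
  ultimately show ?thesis by blast
qed

definition rate :: "real \<Rightarrow> real" where
  "rate b = lim (\<lambda>k. - ln (F k (nat \<lfloor>b * real k\<rfloor>)) / real k)"

lemma le_nat_floor_mult:
  fixes b :: real
  assumes "b \<ge> 1"
  shows "k \<le> nat \<lfloor>b * real k\<rfloor>"
proof -
  have "1 * real k \<le> b * real k" using assms by (intro mult_right_mono) auto
  then show ?thesis by linarith
qed

text \<open>
  Supermultiplicativity of the probabilities makes their negative logarithms subadditive in \<open>k\<close>; they
  are finite because all \<open>k\<close> increments may equal \<open>1\<close>.
\<close>
lemma rate_limit: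
  assumes b: "b \<ge> 1"
  shows "(\<lambda>k. - ln (F k (nat \<lfloor>b * real k\<rfloor>)) / real k) \<longlonglongrightarrow> rate b"
proof -
  have pos: "F k (nat \<lfloor>b * real k\<rfloor>) > 0" for k
    using le_nat_floor_mult[OF b] by (rule F_pos)
  have "convergent (\<lambda>k. - ln (F k (nat \<lfloor>b * real k\<rfloor>)) / real k)"
  proof (rule subadditive_quotient_convergent)
    fix k l
    have "F k (nat \<lfloor>b * real k\<rfloor>) * F l (nat \<lfloor>b * real l\<rfloor>) \<le> F (k + l) (nat \<lfloor>b * real k\<rfloor> + nat \<lfloor>b * real l\<rfloor>)"
      by (rule sum_cdf_supermult[OF p_nonneg])
    also have "\<dots> \<le> F (k + l) (nat \<lfloor>b * real (k + l)\<rfloor>)"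
    proof (rule sum_cdf_mono[OF p_nonneg])
      have "0 \<le> b * real k" "0 \<le> b * real l" "b * real (k + l) = b * real k + b * real l"
        using b by (auto simp: algebra_simps)
      then show "nat \<lfloor>b * real k\<rfloor> + nat \<lfloor>b * real l\<rfloor> \<le> nat \<lfloor>b * real (k + l)\<rfloor>" by linarith
    qed
    finally have "ln (F k (nat \<lfloor>b * real k\<rfloor>) * F l (nat \<lfloor>b * real l\<rfloor>)) \<le> ln (F (k + l) (nat \<lfloor>b * real (k + l)\<rfloor>))"
      using pos by (intro ln_mono) (auto simp del: of_nat_add)
    then show "- ln (F (k + l) (nat \<lfloor>b * real (k + l)\<rfloor>)) \<le> - ln (F k (nat \<lfloor>b * real k\<rfloor>)) + - ln (F l (nat \<lfloor>b * real l\<rfloor>))"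
      using pos[of k] pos[of l] by (simp add: ln_mult del: of_nat_add)
  next
    fix k
    show "- ln (F k (nat \<lfloor>b * real k\<rfloor>)) \<ge> 0"
      using pos[of k] F_le_1 by simp
  qed
  then show ?thesis unfolding rate_def by (rule convergent_LIMSEQ_iff[THEN iffD1])
qed

text \<open>
  The bounds at the truncation level hold for every \<open>k\<close> once \<open>b\<close> is large, so they survive the limit
  \<open>k \<rightarrow> \<infinity>\<close>, in which the factor \<open>2\<close> disappears.
\<close>
lemma rate_asymp_equiv_tail:
  assumes m: "truncation_level m"
  shows "rate \<sim>[at_top] (\<lambda>b. tail (m b))"
proof (rule asymp_equivI', rule tendstoI)
  fix e :: real assume e: "e > 0"
  define \<eta> where "\<eta> = min (e / 2) (1 / 2)"
  have \<eta>: "0 < \<eta>" "\<eta> < 1" "\<eta> < e" using e by (auto simp: \<eta>_def)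
  from F_bounds_at_truncation_level[OF m \<eta>(1,2)] eventually_ge_at_top[of 1]
  show "\<forall>\<^sub>F b in at_top. dist (rate b / tail (m b)) 1 < e"
  proof eventually_elim
    case (elim b)
    define t where "t = tail (m b)"
    have t: "t > 0" by (simp add: t_def tail_pos)
    define a where "a k = - ln (F k (nat \<lfloor>b * real k\<rfloor>)) / real k" for k
    have a: "a \<longlonglongrightarrow> rate b" unfolding a_def[abs_def] by (rule rate_limit) (use elim in auto)
    have bounds: "(1 - \<eta>) * t \<le> a k \<and> a k \<le> (1 + \<eta>) * t + ln 2 / real k" if k: "k \<ge> 1" for k
    proof -
      define n where "n = nat \<lfloor>b * real k\<rfloor>"
      have "1 * 1 \<le> b * real k" using elim k by (intro mult_mono) auto
      then have "1 \<le> b * real k" by simp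
      note n = nat_floor_between(2,3)[OF this, folded n_def]
      have pos: "F k n > 0" unfolding n_def using elim by (intro F_pos le_nat_floor_mult)
      have "exp (- (1 + \<eta>) * (real k * t)) / 2 \<le> F k n \<and> F k n \<le> exp (- (1 - \<eta>) * (real k * t))"
        using elim k n by (auto simp: t_def)
      then have "(1 - \<eta>) * (real k * t) \<le> - ln (F k n)" "- ln (F k n) \<le> (1 + \<eta>) * (real k * t) + ln 2"
        unfolding mult_minus_left using ln_between_exponents[OF pos] by blast+
      then show ?thesis
        using k by (auto simp: a_def n_def[symmetric] field_simps)
    qed
    have "(1 - \<eta>) * t \<le> rate b"
      using bounds by (intro tendsto_lowerbound[OF a]) (auto simp: eventually_sequentially)
    moreover have "rate b \<le> (1 + \<eta>) * t + 0"
    proof (rule tendsto_le[OF _ _ a])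
      show "(\<lambda>k. (1 + \<eta>) * t + ln 2 / real k) \<longlonglongrightarrow> (1 + \<eta>) * t + 0"
        by (intro tendsto_intros lim_const_over_n)
      show "\<forall>\<^sub>F k in sequentially. a k \<le> (1 + \<eta>) * t + ln 2 / real k"
        using bounds by (auto simp: eventually_sequentially)
    qed simp
    ultimately have "1 - \<eta> \<le> rate b / t" "rate b / t \<le> 1 + \<eta>"
      using t by (simp_all only: pos_le_divide_eq pos_divide_le_eq add_0_right)
    then show ?case using \<eta> unfolding t_def[symmetric] dist_real_def by linarith
  qed
qed

end

section \<open>Renewal processes\<close>

lemma ereal_of_enat_le_real_iff:
  assumes "y \<ge> 0"
  shows "ereal_of_enat t \<le> ereal y \<longleftrightarrow> t \<le> enat (nat \<lfloor>y\<rfloor>)"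
proof (cases t)
  case (enat i)
  have "real i \<le> y \<longleftrightarrow> i \<le> nat \<lfloor>y\<rfloor>" using assms by (simp add: le_nat_iff le_floor_iff)
  then show ?thesis using enat by simp
qed simp

text \<open>
  The passage from the process to the recursion. Recurrence enters as \<open>\<Sum>\<^sub>j p\<^sub>j = 1\<close>.
\<close>
lemma renewal_process_slowly_varying_law:
  fixes M :: "'a measure" and \<tau> :: "nat \<Rightarrow> 'a \<Rightarrow> enat"
  assumes renewal: "renewal_process M \<tau>" and rec: "recurrent M \<tau>"
    and sv: "slowly_varying (step_extension \<phi>)"
    and mass: "\<forall>n\<ge>1. \<P>(\<omega> in M. \<tau> 1 \<omega> = enat n) = \<phi> n / real n"
  shows "slowly_varying_law \<phi>"
    and "\<P>(\<omega> in M. \<tau> k \<omega> \<le> enat n) = sum_cdf (slowly_varying_law.p \<phi>) k n"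
    and "renewal_tail M \<tau> x = slowly_varying_law.tail \<phi> (nat \<lfloor>x\<rfloor>)"
proof -
  obtain \<xi> where ind: "prob_space.indep_vars M (\<lambda>_. count_space UNIV) \<xi> UNIV"
    and dist: "\<And>i. distr M (count_space UNIV) (\<xi> i) = distr M (count_space UNIV) (\<xi> 0)"
    and ge1: "\<And>i \<omega>. \<omega> \<in> space M \<Longrightarrow> 1 \<le> \<xi> i \<omega>"
    and \<tau>: "\<And>k \<omega>. \<omega> \<in> space M \<Longrightarrow> \<tau> k \<omega> = (\<Sum>i<k. \<xi> i \<omega>)"
    using renewal by (auto simp: renewal_process_def)
  interpret prob_space M using renewal by (simp add: renewal_process_def)
  have meas [measurable]: "\<xi> 0 \<in> M \<rightarrow>\<^sub>M count_space UNIV"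
    using ind unfolding indep_vars_def by auto
  have \<tau>1: "\<tau> 1 \<omega> = \<xi> 0 \<omega>" if "\<omega> \<in> space M" for \<omega>
    using \<tau>[OF that, of 1] by simp
  have mass': "\<P>(\<omega> in M. \<xi> 0 \<omega> = enat j) = \<phi> j / real j" for j
  proof (cases "j = 0")
    case True
    have "\<xi> 0 \<omega> \<noteq> 0" if "\<omega> \<in> space M" for \<omega>
      using ge1[OF that, of 0] by auto
    then have empty: "{\<omega> \<in> space M. \<xi> 0 \<omega> = enat 0} = {}"
      by (auto simp: enat_0)
    show ?thesis unfolding True empty by simp
  next
    case False
    then have "\<P>(\<omega> in M. \<tau> 1 \<omega> = enat j) = \<phi> j / real j" using mass by simp
    moreover have "{\<omega> \<in> space M. \<tau> 1 \<omega> = enat j} = {\<omega> \<in> space M. \<xi> 0 \<omega> = enat j}"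
      using \<tau>1 by auto
    ultimately show ?thesis by simp
  qed
  have "(\<lambda>j. prob {\<omega> \<in> space M. \<xi> 0 \<omega> = enat j}) sums prob (\<Union>j. {\<omega> \<in> space M. \<xi> 0 \<omega> = enat j})"
    by (rule finite_measure_UNION) (auto simp: disjoint_family_on_def)
  moreover have "(\<Union>j. {\<omega> \<in> space M. \<xi> 0 \<omega> = enat j}) = {\<omega> \<in> space M. \<tau> 1 \<omega> < \<infinity>}"
    using \<tau>1 by (auto simp: less_infinityE)
  ultimately have sums: "(\<lambda>j. \<phi> j / real j) sums 1"
    using rec by (simp add: mass' recurrent_def)
  show law: "slowly_varying_law \<phi>"
    using sv sums by unfold_locales
  interpret slowly_varying_law \<phi> by (rule law)
  have p_eq: "(\<lambda>j. \<P>(\<omega> in M. \<xi> 0 \<omega> = enat j)) = p"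
    by (simp add: fun_eq_iff mass' p_def)
  show cdf: "\<P>(\<omega> in M. \<tau> k \<omega> \<le> enat n) = F k n" for k n
  proof -
    have "{\<omega> \<in> space M. \<tau> k \<omega> \<le> enat n} = {\<omega> \<in> space M. (\<Sum>i<k. \<xi> i \<omega>) \<le> enat n}"
      using \<tau> by auto
    then show ?thesis using prob_sum_le_eq_sum_cdf[OF ind dist] by (simp add: p_eq)
  qed
  show "renewal_tail M \<tau> x = tail (nat \<lfloor>x\<rfloor>)"
  proof (cases "x \<ge> 0")
    case True
    have "{\<omega> \<in> space M. ereal_of_enat (\<tau> 1 \<omega>) > ereal x} = space M - {\<omega> \<in> space M. \<xi> 0 \<omega> \<le> enat (nat \<lfloor>x\<rfloor>)}"
      using ereal_of_enat_le_real_iff[OF True] \<tau>1 by (auto simp: not_le[symmetric])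
    then have "renewal_tail M \<tau> x = 1 - prob {\<omega> \<in> space M. \<xi> 0 \<omega> \<le> enat (nat \<lfloor>x\<rfloor>)}"
      unfolding renewal_tail_def by (simp add: prob_compl)
    also have "{\<omega> \<in> space M. \<xi> 0 \<omega> \<le> enat (nat \<lfloor>x\<rfloor>)} = {\<omega> \<in> space M. \<tau> 1 \<omega> \<le> enat (nat \<lfloor>x\<rfloor>)}"
      using \<tau>1 by auto
    finally show ?thesis by (simp add: cdf tail_def del: One_nat_def) (simp add: One_nat_def)
  next
    case False
    have "ereal x < ereal_of_enat t" for t
      using False by (cases t) auto
    then have "{\<omega> \<in> space M. ereal_of_enat (\<tau> 1 \<omega>) > ereal x} = space M" by auto
    then show ?thesis
      using False unfolding renewal_tail_def by (simp add: prob_space tail_def p_def)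
  qed
qed

theorem theorem1p2:
  fixes M :: "'a measure"
    and \<tau> :: "nat \<Rightarrow> 'a \<Rightarrow> enat"
    and \<phi> :: "nat \<Rightarrow> real"
  defines "r \<equiv> renewal_tail M \<tau>"
  assumes "renewal_process M \<tau>"
    and "recurrent M \<tau>"
    and "slowly_varying (step_extension \<phi>)"
    and "\<forall>n\<ge>1. \<P>(\<omega> in M. \<tau> 1 \<omega> = enat n) = \<phi> n / real n"
  shows
    "(\<exists>a :: real \<Rightarrow> real. (\<forall>C>0. a C > 0) \<and> (a \<longlongrightarrow> 1) (at_right 0) \<and>
        (\<forall>C>0. \<forall>\<^sub>F n in sequentially. \<forall>k. 1 \<le> k \<and> k \<le> n \<and> real k * \<phi> n \<le> C \<longrightarrow>
           a C * (1 - r (real n)) ^ k \<le> \<P>(\<omega> in M. \<tau> k \<omega> \<le> enat n) \<and>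
           \<P>(\<omega> in M. \<tau> k \<omega> \<le> enat n) \<le> (1 - r (real n)) ^ k))
     \<and>
     (\<forall>\<phi>'. conjugate_slowly_varying (step_extension \<phi>) \<phi>' \<longrightarrow>
        (\<forall>k n :: nat \<Rightarrow> nat.
           (\<forall>j. 1 \<le> k j \<and> k j \<le> n j) \<and>
           filterlim k at_top sequentially \<and> filterlim n at_top sequentially \<and>
           filterlim (\<lambda>j. real (k j) * \<phi> (n j)) at_top sequentially \<and>
           filterlim (\<lambda>j. real (n j) / real (k j)) at_top sequentially \<longrightarrow>
           (\<exists>\<epsilon> :: nat \<Rightarrow> real. \<epsilon> \<longlonglongrightarrow> 0 \<and>
              (\<forall>j. \<P>(\<omega> in M. \<tau> (k j) \<omega> \<le> enat (n j)) =
                 exp (- ((1 + \<epsilon> j) * real (k j) *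
                   r (real (n j) / real (k j) * \<phi>' (real (n j) / real (k j)))))))))
     \<and>
     (\<exists>I :: real \<Rightarrow> ereal.
        (\<forall>b\<ge>1. (\<lambda>k. ereal (1 / real k) *
            log_prob (\<P>(\<omega> in M. ereal_of_enat (\<tau> k \<omega>) \<le> ereal (b * real k))))
          \<longlonglongrightarrow> - I b) \<and>
        (\<forall>b\<ge>1. b \<ge> real (LEAST j. \<P>(\<omega> in M. \<tau> 1 \<omega> = enat j) > 0) \<longrightarrow> \<bar>I b\<bar> \<noteq> \<infinity>) \<and>
        (\<forall>\<phi>'. conjugate_slowly_varying (step_extension \<phi>) \<phi>' \<longrightarrow>
           (\<lambda>b. real_of_ereal (I b)) \<sim>[at_top] (\<lambda>b. r (b * \<phi>' b))))"
proof -
  note law = renewal_process_slowly_varying_law[OF assms(2-5)]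
  interpret slowly_varying_law \<phi> by (rule law(1))
  have cdf: "\<P>(\<omega> in M. \<tau> k \<omega> \<le> enat n) = F k n" for k n by (rule law(2))
  have r: "r x = tail (nat \<lfloor>x\<rfloor>)" for x unfolding r_def by (rule law(3))
  have upper: "F k n \<le> (1 - tail n) ^ k" for k n
    using sum_cdf_le_power[OF p_nonneg] by (simp add: tail_def)
  have cdf_real: "\<P>(\<omega> in M. ereal_of_enat (\<tau> k \<omega>) \<le> ereal (b * real k)) = F k (nat \<lfloor>b * real k\<rfloor>)"
    if "b \<ge> 1" for b k
    using that by (simp add: ereal_of_enat_le_real_iff cdf)
  have part1: "\<exists>a :: real \<Rightarrow> real. (\<forall>C>0. a C > 0) \<and> (a \<longlongrightarrow> 1) (at_right 0) \<and>
        (\<forall>C>0. \<forall>\<^sub>F n in sequentially. \<forall>k. 1 \<le> k \<and> k \<le> n \<and> real k * \<phi> n \<le> C \<longrightarrow>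
           a C * (1 - tail n) ^ k \<le> F k n \<and> F k n \<le> (1 - tail n) ^ k)"
  proof -
    obtain a :: "real \<Rightarrow> real" where a: "\<forall>C>0. a C > 0" "(a \<longlongrightarrow> 1) (at_right 0)"
      "\<And>C. C > 0 \<Longrightarrow> \<forall>\<^sub>F n in sequentially. \<forall>k. real k * \<phi> n \<le> C \<longrightarrow> a C * (1 - tail n) ^ k \<le> F k n"
      using F_ge_max_power_function by blast
    have "\<forall>\<^sub>F n in sequentially. \<forall>k. 1 \<le> k \<and> k \<le> n \<and> real k * \<phi> n \<le> C \<longrightarrow>
        a C * (1 - tail n) ^ k \<le> F k n \<and> F k n \<le> (1 - tail n) ^ k" if "C > 0" for C
      using a(3)[OF that] by eventually_elim (use upper in blast)
    with a(1,2) show ?thesis by blast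
  qed
  have part2: "\<exists>\<epsilon> :: nat \<Rightarrow> real. \<epsilon> \<longlonglongrightarrow> 0 \<and>
      (\<forall>j. F (k j) (n j) = exp (- ((1 + \<epsilon> j) * real (k j) *
          tail (nat \<lfloor>real (n j) / real (k j) * \<phi>' (real (n j) / real (k j))\<rfloor>))))"
    if "conjugate_slowly_varying (step_extension \<phi>) \<phi>'"
      "(\<forall>j. 1 \<le> k j \<and> k j \<le> n j) \<and>
       filterlim k at_top sequentially \<and> filterlim n at_top sequentially \<and>
       filterlim (\<lambda>j. real (k j) * \<phi> (n j)) at_top sequentially \<and>
       filterlim (\<lambda>j. real (n j) / real (k j)) at_top sequentially"
    for \<phi>' and k n :: "nat \<Rightarrow> nat"
    using F_eq_exp_tail[OF truncation_level_conjugate[OF that(1)], of k n] that(2) by blast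
  have part3_limit: "(\<lambda>k. ereal (1 / real k) *
      log_prob (\<P>(\<omega> in M. ereal_of_enat (\<tau> k \<omega>) \<le> ereal (b * real k)))) \<longlonglongrightarrow> - ereal (rate b)"
    if b: "b \<ge> 1" for b
  proof -
    have pos: "F k (nat \<lfloor>b * real k\<rfloor>) > 0" for k
      by (rule F_pos[OF le_nat_floor_mult[OF b]])
    have eq: "ereal (1 / real k) * log_prob (F k (nat \<lfloor>b * real k\<rfloor>)) =
        ereal (- (- ln (F k (nat \<lfloor>b * real k\<rfloor>)) / real k))" for k
      using pos[of k] by (simp add: log_prob_def)
    have "(\<lambda>k. - (- ln (F k (nat \<lfloor>b * real k\<rfloor>)) / real k)) \<longlonglongrightarrow> - rate b"
      by (rule tendsto_minus[OF rate_limit[OF b]])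
    then show ?thesis
      unfolding cdf_real[OF b] eq uminus_ereal.simps by (rule tendsto_ereal)
  qed
  have part3_asymp: "rate \<sim>[at_top] (\<lambda>b. tail (nat \<lfloor>b * \<phi>' b\<rfloor>))"
    if "conjugate_slowly_varying (step_extension \<phi>) \<phi>'" for \<phi>'
    by (rule rate_asymp_equiv_tail[OF truncation_level_conjugate[OF that]])
  show ?thesis
    unfolding cdf r floor_of_nat nat_int
  proof (intro conjI)
    show "\<exists>I :: real \<Rightarrow> ereal.
        (\<forall>b\<ge>1. (\<lambda>k. ereal (1 / real k) *
            log_prob (\<P>(\<omega> in M. ereal_of_enat (\<tau> k \<omega>) \<le> ereal (b * real k)))) \<longlonglongrightarrow> - I b) \<and>
        (\<forall>b\<ge>1. b \<ge> real (LEAST j. \<P>(\<omega> in M. \<tau> 1 \<omega> = enat j) > 0) \<longrightarrow> \<bar>I b\<bar> \<noteq> \<infinity>) \<and>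
        (\<forall>\<phi>'. conjugate_slowly_varying (step_extension \<phi>) \<phi>' \<longrightarrow>
           (\<lambda>b. real_of_ereal (I b)) \<sim>[at_top] (\<lambda>b. tail (nat \<lfloor>b * \<phi>' b\<rfloor>)))"
      by (rule exI[of _ "\<lambda>b. ereal (rate b)"]) (use part3_limit part3_asymp in auto)
  qed (use part1 part2 in blast)+
qed

end
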